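(* The set of first order sentences $\varphi$ (in the language of graphs) such that $G(n\mid\varphi)$ obeys the FO 0--1 law is not recursively enumerable.
   Context: For a first order sentence $\varphi$ over the signature $\{=,\sim\}$, $G(n\mid\varphi)$ is a graph chosen uniformly at random from all simple undirected loopless graphs on $[n]$ satisfying $\varphi$. $G(n\mid\varphi)$ obeys the FO 0--1 law if for every first order sentence $\psi$, $\Pr(G(n\mid\varphi)\models\psi)$ converges to $0$ or to $1$ as $n\to\infty$. The decision problem takes a FO sentence $\varphi$ as input. *)

theory Defs
  imports "HOL-Probability.Probability" "HOL-Library.Nat_Bijection"
begin

datatype fm =
    FEq nat nat
  | FAdj nat nat
  | FNeg fm
  | FConj fm fm
  | FDisj fm fm
  | FImp fm fm
  | FEx nat fm
  | FAll nat fm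

primrec fv :: "fm \<Rightarrow> nat set" where
  "fv (FEq x y) = {x, y}"
| "fv (FAdj x y) = {x, y}"
| "fv (FNeg p) = fv p"
| "fv (FConj p q) = fv p \<union> fv q"
| "fv (FDisj p q) = fv p \<union> fv q"
| "fv (FImp p q) = fv p \<union> fv q"
| "fv (FEx x p) = fv p - {x}"
| "fv (FAll x p) = fv p - {x}"

definition sentence :: "fm \<Rightarrow> bool" where
  "sentence p \<longleftrightarrow> fv p = {}"

text \<open>A graph is given by its vertex set and its set of edges, an edge being a two-element set.\<close>

primrec sat :: "'v set \<Rightarrow> 'v set set \<Rightarrow> (nat \<Rightarrow> 'v) \<Rightarrow> fm \<Rightarrow> bool" where
  "sat V E s (FEq x y) \<longleftrightarrow> s x = s y"
| "sat V E s (FAdj x y) \<longleftrightarrow> {s x, s y} \<in> E"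
| "sat V E s (FNeg p) \<longleftrightarrow> \<not> sat V E s p"
| "sat V E s (FConj p q) \<longleftrightarrow> sat V E s p \<and> sat V E s q"
| "sat V E s (FDisj p q) \<longleftrightarrow> sat V E s p \<or> sat V E s q"
| "sat V E s (FImp p q) \<longleftrightarrow> (sat V E s p \<longrightarrow> sat V E s q)"
| "sat V E s (FEx x p) \<longleftrightarrow> (\<exists>v\<in>V. sat V E (s(x := v)) p)"
| "sat V E s (FAll x p) \<longleftrightarrow> (\<forall>v\<in>V. sat V E (s(x := v)) p)"

definition graphs_on :: "nat \<Rightarrow> nat set set set" where
  "graphs_on n = Pow {e. e \<subseteq> {1..n} \<and> card e = 2}"

text \<open>For a sentence the truth value does not depend on the assignment.\<close>

definition graph_sat :: "nat \<Rightarrow> nat set set \<Rightarrow> fm \<Rightarrow> bool" where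
  "graph_sat n E p \<longleftrightarrow> (\<forall>s. sat {1..n} E s p)"

definition graphs_sat :: "nat \<Rightarrow> fm \<Rightarrow> nat set set set" where
  "graphs_sat n p = {E \<in> graphs_on n. graph_sat n E p}"

text \<open>The random graph \<open>G(n | p)\<close>; it is meaningful only if \<open>graphs_sat n p \<noteq> {}\<close>.\<close>

definition cond_graph :: "nat \<Rightarrow> fm \<Rightarrow> nat set set pmf" where
  "cond_graph n p = pmf_of_set (graphs_sat n p)"

definition spectrum :: "fm \<Rightarrow> nat set" where
  "spectrum p = {n. graphs_sat n p \<noteq> {}}"

text \<open>The limit \<open>n \<rightarrow> \<infinity>\<close> is taken along those \<open>n\<close> for which \<open>G(n | p)\<close> exists,
  of which there have to be infinitely many.\<close>

definition obeys_zero_one_law :: "fm \<Rightarrow> bool" where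
  "obeys_zero_one_law p \<longleftrightarrow>
     infinite (spectrum p) \<and>
     (\<forall>q. sentence q \<longrightarrow>
        (\<exists>c\<in>{0, 1}.
          ((\<lambda>n. measure_pmf.prob (cond_graph n p) {E. graph_sat n E q}) \<longlongrightarrow> c)
            (inf sequentially (principal (spectrum p)))))"

primrec fm_code :: "fm \<Rightarrow> nat" where
  "fm_code (FEq x y) = prod_encode (0, prod_encode (x, y))"
| "fm_code (FAdj x y) = prod_encode (1, prod_encode (x, y))"
| "fm_code (FNeg p) = prod_encode (2, fm_code p)"
| "fm_code (FConj p q) = prod_encode (3, prod_encode (fm_code p, fm_code q))"
| "fm_code (FDisj p q) = prod_encode (4, prod_encode (fm_code p, fm_code q))"
| "fm_code (FImp p q) = prod_encode (5, prod_encode (fm_code p, fm_code q))"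
| "fm_code (FEx x p) = prod_encode (6, prod_encode (x, fm_code p))"
| "fm_code (FAll x p) = prod_encode (7, prod_encode (x, fm_code p))"

lemma fm_code_eq_iff: "fm_code p = fm_code q \<longleftrightarrow> p = q"
proof (induction p arbitrary: q)
  case (FEq x y) show ?case by (cases q) auto
next
  case (FAdj x y) show ?case by (cases q) auto
next
  case (FNeg p) then show ?case by (cases q) auto
next
  case (FConj p1 p2) then show ?case by (cases q) auto
next
  case (FDisj p1 p2) then show ?case by (cases q) auto
next
  case (FImp p1 p2) then show ?case by (cases q) auto
next
  case (FEx x p) then show ?case by (cases q) auto
next
  case (FAll x p) then show ?case by (cases q) auto
qed

text \<open>Programs for the partial recursive (\<open>\<mu>\<close>-recursive) functions. They carry no arity; at each
  number of arguments a program denotes a partial recursive function, undefined on arguments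
  to which no rule below applies. The recursion variable of \<open>PrimRec\<close> and the
  search variable of \<open>Mu\<close> are the first argument.\<close>

datatype recf =
    Zero
  | Succ
  | Proj nat
  | Comp recf "recf list"
  | PrimRec recf recf
  | Mu recf

inductive computes :: "recf \<Rightarrow> nat list \<Rightarrow> nat \<Rightarrow> bool" where
  Zero: "computes Zero xs 0"
| Succ: "computes Succ [x] (Suc x)"
| Proj: "i < length xs \<Longrightarrow> computes (Proj i) xs (xs ! i)"
| Comp: "list_all2 (\<lambda>g y. computes g xs y) gs ys \<Longrightarrow> computes f ys z \<Longrightarrow>
    computes (Comp f gs) xs z"
| PrimRec_0: "computes f xs z \<Longrightarrow> computes (PrimRec f g) (0 # xs) z"
| PrimRec_Suc: "computes (PrimRec f g) (n # xs) y \<Longrightarrow> computes g (n # y # xs) z \<Longrightarrow>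
    computes (PrimRec f g) (Suc n # xs) z"
| Mu: "computes f (n # xs) 0 \<Longrightarrow> \<forall>m<n. \<exists>y>0. computes f (m # xs) y \<Longrightarrow>
    computes (Mu f) xs n"

definition recursively_enumerable :: "nat set \<Rightarrow> bool" where
  "recursively_enumerable A \<longleftrightarrow> (\<exists>f. A = {x. \<exists>y. computes f [x] y})"

end

theory Submission
  imports Defs
begin

text \<open>
  Suppose a program \<open>f\<close> semi-decides the zero-one law. For a program \<open>h\<close> and an input \<open>x\<close> there is a
  sentence whose finite models are the edgeless graphs together with graphs containing a
  certificate that \<open>h\<close> halts on \<open>x\<close>. If \<open>h\<close> does not halt on \<open>x\<close>, only the edgeless graphs remain
  and the law holds. If it halts, there are arbitrarily large further models, and complementation
  is a bijection between those having an isolated vertex and those having a dominating vertex, so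
  the probability of a dominating vertex is infinitely often between a third and a half and the law
  fails. By diagonalisation, as in Goedel's theorem, one can take for \<open>h\<close> the program that runs
  \<open>f\<close> on the sentence belonging to \<open>h\<close> and \<open>x\<close>: then \<open>h\<close> halts on \<open>x\<close> iff it does not.

  Certificates use one definable ternary relation \<open>T\<close>. A vertex \<open>c\<close> codes the binary relation
  \<open>T c\<close>, a distinguished vertex \<open>z\<close> codes the successor relation, and a vertex has the value \<open>n\<close> if
  \<open>n\<close> predecessor steps lead to a vertex without predecessor. Primitive recursion and search are
  expressed by the existence of a code whose members are locally justified. This is sound for
  every \<open>T\<close>, so that no axioms on the graph are required; it is complete in a graph
  in which all relations on a long enough initial segment of the numbers have codes.
\<close>

section \<open>Programs\<close>

text \<open>The premise has the shape of the induction hypothesis that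
  \<open>computes.induct\<close> yields for the argument list of \<open>Comp\<close>.\<close>

lemma list_all2_unique:
  assumes "list_all2 (\<lambda>x y. P x y \<and> (\<forall>y'. P x y' \<longrightarrow> y = y')) xs ys" "list_all2 P xs zs"
  shows "ys = zs"
  using assms by (induction xs ys arbitrary: zs rule: list_all2_induct) (auto simp: list_all2_Cons1)

inductive_cases computes_elims:
  "computes Zero xs y" "computes Succ xs y" "computes (Proj i) xs y"
  "computes (Comp f gs) xs y" "computes (PrimRec f g) xs y" "computes (Mu f) xs y"

lemma computes_functional: "computes f xs y \<Longrightarrow> computes f xs y' \<Longrightarrow> y = y'"
proof (induction arbitrary: y' rule: computes.induct)
  case (Zero xs)
  then show ?case by (rule computes_elims) auto
next
  case (Succ x)
  then show ?case by (rule computes_elims) auto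
next
  case (Proj i xs)
  from Proj.prems show ?case by (rule computes_elims) auto
next
  case (Comp xs gs ys f z)
  from Comp.prems obtain ys' where ys': "list_all2 (\<lambda>g y. computes g xs y) gs ys'" "computes f ys' y'"
    by (rule computes_elims)
  have "ys = ys'"
    using list_all2_unique[OF Comp.IH(1) ys'(1)] .
  with ys'(2) Comp.IH(2) show ?case by simp
next
  case (PrimRec_0 f xs z g)
  from PrimRec_0.prems show ?case by (rule computes_elims) (use PrimRec_0.IH in auto)
next
  case (PrimRec_Suc f g n xs y z)
  from PrimRec_Suc.prems show ?case
  proof (rule computes_elims(5))
    fix n' xs' u
    assume "Suc n # xs = Suc n' # xs'" "computes (PrimRec f g) (n' # xs') u"
      "computes g (n' # u # xs') y'"
    with PrimRec_Suc.IH show "z = y'" by (metis list.inject nat.inject)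
  qed simp
next
  case (Mu f n xs)
  from Mu.prems have y': "computes f (y' # xs) 0" "\<forall>m<y'. \<exists>y>0. computes f (m # xs) y"
    by (rule computes_elims, simp)+
  show ?case
  \<comment> \<open>If the results differ, \<open>f\<close> has value 0 at the smaller one, while
    the search for the larger one requires a positive value there.\<close>
  proof (cases n y' rule: linorder_cases)
    case less
    with y' Mu.IH(1) show ?thesis by (metis less_irrefl)
  next
    case greater
    with y' Mu.IH(2) show ?thesis by (metis less_irrefl)
  qed
qed

section \<open>Programs computing codes of formulas\<close>

primrec const_prog :: "nat \<Rightarrow> recf" where
  "const_prog 0 = Zero"
| "const_prog (Suc n) = Comp Succ [const_prog n]"

definition add_prog :: recf where
  "add_prog = PrimRec (Proj 0) (Comp Succ [Proj 1])"

definition triangle_prog :: recf where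
  "triangle_prog = PrimRec Zero (Comp Succ [Comp add_prog [Proj 0, Proj 1]])"

text \<open>Cantor pairing: \<open>prod_encode (a, b) = triangle (a + b) + a\<close>.\<close>

definition pair_prog :: "recf \<Rightarrow> recf \<Rightarrow> recf" where
  "pair_prog f g = Comp add_prog [Comp triangle_prog [Comp add_prog [f, g]], f]"

lemma computes_Comp1: "computes g xs a \<Longrightarrow> computes f [a] z \<Longrightarrow> computes (Comp f [g]) xs z"
  by (rule Comp[where ys = "[a]"]) auto

lemma computes_Comp2:
  "computes g xs a \<Longrightarrow> computes h xs b \<Longrightarrow> computes f [a, b] z \<Longrightarrow> computes (Comp f [g, h]) xs z"
  by (rule Comp[where ys = "[a, b]"]) auto

lemma computes_Proj: "i < length xs \<Longrightarrow> y = xs ! i \<Longrightarrow> computes (Proj i) xs y"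
  by (simp add: computes.Proj)

lemma computes_const: "computes (const_prog n) xs n"
  by (induction n) (auto intro: computes.intros computes_Comp1)

lemma computes_add: "computes add_prog [m, n] (m + n)"
  unfolding add_prog_def
proof (induction m)
  case 0
  show ?case by (rule PrimRec_0) (simp add: computes_Proj)
next
  case (Suc m)
  show ?case
    by (rule PrimRec_Suc[OF Suc]) (auto intro!: computes_Comp1 computes_Proj computes.Succ)
qed

lemma computes_triangle: "computes triangle_prog [n] (triangle n)"
  unfolding triangle_prog_def
proof (induction n)
  case 0
  show ?case by (rule PrimRec_0) (simp add: computes.Zero)
next
  case (Suc n)
  have "computes (Comp Succ [Comp add_prog [Proj 0, Proj 1]]) [n, triangle n] (Suc (n + triangle n))"
    by (rule computes_Comp1[OF computes_Comp2[OF _ _ computes_add] computes.Succ])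
      (auto intro: computes_Proj)
  then show ?case
    using PrimRec_Suc[OF Suc] by (simp add: add.commute)
qed

lemma computes_pair:
  assumes "computes f xs a" "computes g xs b"
  shows "computes (pair_prog f g) xs (prod_encode (a, b))"
  unfolding pair_prog_def prod_encode_def prod.case
  by (rule computes_Comp2[OF computes_Comp1[OF computes_Comp2[OF assms computes_add] computes_triangle]
        assms(1) computes_add])

text \<open>The constants 3, 4 and 6 in this and the next two definitions are the constructor tags
  of \<open>fm_code\<close>.\<close>

definition conj_prog :: "recf \<Rightarrow> recf \<Rightarrow> recf" where
  "conj_prog f g = pair_prog (const_prog 3) (pair_prog f g)"

definition disj_prog :: "recf \<Rightarrow> recf \<Rightarrow> recf" where
  "disj_prog f g = pair_prog (const_prog 4) (pair_prog f g)"

definition ex_prog :: "nat \<Rightarrow> recf \<Rightarrow> recf" where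
  "ex_prog x f = pair_prog (const_prog 6) (pair_prog (const_prog x) f)"

lemma computes_conj:
  "computes f xs (fm_code p) \<Longrightarrow> computes g xs (fm_code q) \<Longrightarrow>
    computes (conj_prog f g) xs (fm_code (FConj p q))"
  unfolding conj_prog_def fm_code.simps by (intro computes_pair computes_const)

lemma computes_disj:
  "computes f xs (fm_code p) \<Longrightarrow> computes g xs (fm_code q) \<Longrightarrow>
    computes (disj_prog f g) xs (fm_code (FDisj p q))"
  unfolding disj_prog_def fm_code.simps by (intro computes_pair computes_const)

lemma computes_ex:
  "computes f xs (fm_code p) \<Longrightarrow> computes (ex_prog x f) xs (fm_code (FEx x p))"
  unfolding ex_prog_def fm_code.simps by (intro computes_pair computes_const)

section \<open>Arithmetic in a ternary relation\<close>

definition zero_at :: "'v set \<Rightarrow> ('v \<Rightarrow> 'v \<Rightarrow> bool) \<Rightarrow> 'v \<Rightarrow> bool" where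
  "zero_at V S v \<longleftrightarrow> (\<forall>u\<in>V. \<not> S u v)"

text \<open>\<open>S\<close> may be any relation, so uniqueness of the predecessor is built in.
  Hence a vertex has at most one value, although several vertices may share a value.\<close>

definition succ_at :: "'v set \<Rightarrow> ('v \<Rightarrow> 'v \<Rightarrow> bool) \<Rightarrow> 'v \<Rightarrow> 'v \<Rightarrow> bool" where
  "succ_at V S u v \<longleftrightarrow> S u v \<and> (\<forall>u'\<in>V. S u' v \<longrightarrow> u' = u)"

primrec has_value :: "'v set \<Rightarrow> ('v \<Rightarrow> 'v \<Rightarrow> bool) \<Rightarrow> nat \<Rightarrow> 'v \<Rightarrow> bool" where
  "has_value V S 0 v \<longleftrightarrow> zero_at V S v"
| "has_value V S (Suc n) v \<longleftrightarrow> (\<exists>u\<in>V. succ_at V S u v \<and> has_value V S n u)"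

lemma has_value_zero_at: "has_value V S n v \<Longrightarrow> zero_at V S v \<Longrightarrow> n = 0"
  by (cases n) (auto simp: zero_at_def succ_at_def)

lemma has_value_succ_at:
  assumes "has_value V S n v" "succ_at V S u v" "u \<in> V"
  shows "\<exists>m. n = Suc m \<and> has_value V S m u"
proof (cases n)
  case 0
  with assms show ?thesis by (simp add: zero_at_def succ_at_def)
next
  case (Suc m)
  with assms(1) obtain u' where "u' \<in> V" "succ_at V S u' v" "has_value V S m u'"
    by auto
  moreover from this assms(2,3) have "u' = u"
    unfolding succ_at_def by blast
  ultimately show ?thesis using Suc by simp
qed

text \<open>For \<open>Mu\<close>, the code \<open>l\<close> of a strict order is demanded because nothing else forces the result
  \<open>w\<close> to have a value: it could lie on a cycle of the successor relation.\<close>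

primrec computes_in :: "'v set \<Rightarrow> ('v \<Rightarrow> 'v \<Rightarrow> 'v \<Rightarrow> bool) \<Rightarrow> 'v \<Rightarrow> recf \<Rightarrow> 'v list \<Rightarrow> 'v \<Rightarrow> bool" where
  "computes_in V T z Zero = (\<lambda>vs w. zero_at V (T z) w)"
| "computes_in V T z Succ = (\<lambda>vs w. length vs = 1 \<and> succ_at V (T z) (hd vs) w)"
| "computes_in V T z (Proj i) = (\<lambda>vs w. i < length vs \<and> vs ! i = w)"
| "computes_in V T z (Comp f gs) = (\<lambda>vs w. \<exists>us. set us \<subseteq> V \<and>
     list_all2 (\<lambda>G u. G vs u) (map (computes_in V T z) gs) us \<and> computes_in V T z f us w)"
| "computes_in V T z (PrimRec f g) = (\<lambda>vs w. vs \<noteq> [] \<and> (\<exists>c\<in>V. T c (hd vs) w \<and>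
     (\<forall>i\<in>V. \<forall>y\<in>V. T c i y \<longrightarrow>
        zero_at V (T z) i \<and> computes_in V T z f (tl vs) y \<or>
        (\<exists>i'\<in>V. \<exists>y'\<in>V. T c i' y' \<and> succ_at V (T z) i' i \<and> computes_in V T z g (i' # y' # tl vs) y))))"
| "computes_in V T z (Mu f) = (\<lambda>vs w.
     (\<exists>u\<in>V. zero_at V (T z) u \<and> computes_in V T z f (w # vs) u) \<and>
     (\<exists>l\<in>V. (\<forall>i\<in>V. \<not> T l i i) \<and>
       (\<forall>i\<in>V. \<forall>j\<in>V. \<forall>k\<in>V. T l i j \<and> T l j k \<longrightarrow> T l i k) \<and>
       (\<exists>c\<in>V. T c w w \<and>
         (\<forall>i\<in>V. T c i i \<longrightarrow> zero_at V (T z) i \<or>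
           (\<exists>i'\<in>V. T c i' i' \<and> T l i' i \<and> succ_at V (T z) i' i \<and>
             (\<exists>y\<in>V. (\<exists>u\<in>V. succ_at V (T z) u y) \<and> computes_in V T z f (i' # vs) y))))))"

lemma list_all2_exists:
  assumes "\<And>g u. g \<in> set gs \<Longrightarrow> u \<in> set us \<Longrightarrow> P g u \<Longrightarrow> \<exists>m. Q m u \<and> R g m" "list_all2 P gs us"
  shows "\<exists>ms. list_all2 Q ms us \<and> list_all2 R gs ms"
  using assms(2,1)
proof (induction gs us rule: list_all2_induct)
  case Nil then show ?case by auto
next
  case (Cons g gs u us)
  then obtain ms m where "list_all2 Q ms us" "list_all2 R gs ms" "Q m u" "R g m"
    by (metis list.set_intros)
  then show ?case by (intro exI[of _ "m # ms"]) auto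
qed

text \<open>Induction on the program. Local justification suffices because it can be followed
  downwards: for \<open>PrimRec\<close> along the value of the recursion argument, for
  \<open>Mu\<close> along the order coded by \<open>l\<close>.\<close>

lemma computes_in_sound:
  assumes "finite V" "computes_in V T z f vs w" "list_all2 (has_value V (T z)) ns vs" "set vs \<subseteq> V" "w \<in> V"
  shows "\<exists>m. has_value V (T z) m w \<and> computes f ns m"
  using assms(2-)
proof (induction f arbitrary: vs w ns)
  case Zero
  then show ?case by (intro exI[of _ 0]) (auto intro: computes.Zero)
next
  case Succ
  then obtain v n where "vs = [v]" "ns = [n]" "has_value V (T z) n v" "succ_at V (T z) v w" "v \<in> V"
    by (auto simp: length_Suc_conv list_all2_Cons2)
  then show ?case by (intro exI[of _ "Suc n"]) (auto intro: computes.Succ)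
next
  case (Proj i)
  then show ?case
    by (intro exI[of _ "ns ! i"]) (auto intro: computes.Proj simp: list_all2_conv_all_nth)
next
  case (Comp f gs)
  then obtain us where us: "set us \<subseteq> V" "list_all2 (\<lambda>g u. computes_in V T z g vs u) gs us" "computes_in V T z f us w"
    by (auto simp: list_all2_map1)
  have "\<exists>ms. list_all2 (has_value V (T z)) ms us \<and> list_all2 (\<lambda>g m. computes g ns m) gs ms"
  proof (rule list_all2_exists[OF _ us(2)])
    fix g u assume "g \<in> set gs" "u \<in> set us" "computes_in V T z g vs u"
    with Comp.IH(2) Comp.prems(2,3) us(1) show "\<exists>m. has_value V (T z) m u \<and> computes g ns m"
      by (meson subsetD)
  qed
  then obtain ms where ms: "list_all2 (has_value V (T z)) ms us" "list_all2 (\<lambda>g m. computes g ns m) gs ms"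
    by (elim exE conjE)
  from Comp.IH(1)[OF us(3) ms(1) us(1) Comp.prems(4)] computes.Comp[OF ms(2)] show ?case by blast
next
  case (PrimRec f g)
  then obtain v vs' n ns' where eq: "vs = v # vs'" "ns = n # ns'"
    and v: "has_value V (T z) n v" "v \<in> V" and vs': "list_all2 (has_value V (T z)) ns' vs'" "set vs' \<subseteq> V"
    by (cases vs) (auto simp: list_all2_Cons2)
  from PrimRec.prems(1) obtain c where c: "T c v w"
    and just: "\<And>i y. i \<in> V \<Longrightarrow> y \<in> V \<Longrightarrow> T c i y \<Longrightarrow>
        zero_at V (T z) i \<and> computes_in V T z f vs' y \<or>
        (\<exists>i'\<in>V. \<exists>y'\<in>V. T c i' y' \<and> succ_at V (T z) i' i \<and> computes_in V T z g (i' # y' # vs') y)"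
    by (auto simp: eq)
  have "\<exists>m. has_value V (T z) m y \<and> computes (PrimRec f g) (k # ns') m"
    if "has_value V (T z) k i" "T c i y" "i \<in> V" "y \<in> V" for k i y
    using that
  proof (induction k arbitrary: i y)
    case 0
    \<comment> \<open>A vertex of value 0 has no predecessor, so only the base clause can justify
      the pair.\<close>
    then have "\<not> succ_at V (T z) i' i" if "i' \<in> V" for i'
      using has_value_succ_at[of V "T z" 0 i i'] that by auto
    then have "computes_in V T z f vs' y"
      using just[OF 0(3,4,2)] by blast
    from PrimRec.IH(1)[OF this vs' 0(4)] show ?case by (blast intro: PrimRec_0)
  next
    case (Suc k)
    then have "\<not> zero_at V (T z) i"
      using has_value_zero_at[of V "T z" "Suc k" i] by auto
    then obtain i' y' where *: "i' \<in> V" "y' \<in> V" "T c i' y'" "succ_at V (T z) i' i"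
        "computes_in V T z g (i' # y' # vs') y"
      using just[OF Suc.prems(3,4,2)] by blast
    then have k: "has_value V (T z) k i'"
      using has_value_succ_at[OF Suc.prems(1)] by blast
    from Suc.IH[OF this *(3,1,2)] obtain m where m: "has_value V (T z) m y'" "computes (PrimRec f g) (k # ns') m"
      by blast
    have "\<exists>m'. has_value V (T z) m' y \<and> computes g (k # m # ns') m'"
      using k m * vs' Suc.prems by (intro PrimRec.IH(2)[OF *(5)]) auto
    then show ?case using PrimRec_Suc[OF m(2)] by blast
  qed
  from this[OF v(1) c v(2) \<open>w \<in> V\<close>] show ?case by (simp add: eq)
next
  case (Mu f)
  from Mu.prems(1) have prems: "\<exists>u\<in>V. zero_at V (T z) u \<and> computes_in V T z f (w # vs) u"
     "\<exists>l\<in>V. (\<forall>i\<in>V. \<not> T l i i) \<and>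
       (\<forall>i\<in>V. \<forall>j\<in>V. \<forall>k\<in>V. T l i j \<and> T l j k \<longrightarrow> T l i k) \<and>
       (\<exists>c\<in>V. T c w w \<and>
         (\<forall>i\<in>V. T c i i \<longrightarrow> zero_at V (T z) i \<or>
           (\<exists>i'\<in>V. T c i' i' \<and> T l i' i \<and> succ_at V (T z) i' i \<and>
             (\<exists>y\<in>V. (\<exists>u\<in>V. succ_at V (T z) u y) \<and> computes_in V T z f (i' # vs) y))))"
    by simp_all
  from prems(1) obtain u where u: "u \<in> V" "zero_at V (T z) u" "computes_in V T z f (w # vs) u"
    by blast
  from prems(2) obtain l c where irr: "\<forall>i\<in>V. \<not> T l i i"
    and tr: "\<forall>i\<in>V. \<forall>j\<in>V. \<forall>k\<in>V. T l i j \<and> T l j k \<longrightarrow> T l i k"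
    and c: "T c w w"
    and just: "\<forall>i\<in>V. T c i i \<longrightarrow> zero_at V (T z) i \<or>
         (\<exists>i'\<in>V. T c i' i' \<and> T l i' i \<and> succ_at V (T z) i' i \<and>
           (\<exists>y\<in>V. (\<exists>u\<in>V. succ_at V (T z) u y) \<and> computes_in V T z f (i' # vs) y))"
    by (elim bexE conjE)
  \<comment> \<open>A strict order on a finite set is well-founded, so the predecessor steps from
    \<open>w\<close> inside \<open>c\<close> cannot cycle and end at a zero vertex. The induction
    along \<open>r\<close> also collects the positive values of \<open>f\<close> met on the
    way.\<close>
  define r where "r = {(i, j). i \<in> V \<and> j \<in> V \<and> T l i j}"
  have "r \<subseteq> V \<times> V" "irrefl r"
    unfolding r_def using irr by (auto simp: irrefl_def)
  moreover have "trans r"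
    unfolding r_def trans_def using tr by blast
  ultimately have "acyclic r"
    by (simp add: acyclic_irrefl)
  moreover have "finite r"
    using \<open>r \<subseteq> V \<times> V\<close> \<open>finite V\<close> by (meson finite_SigmaI finite_subset)
  ultimately have "wf r"
    by (intro finite_acyclic_wf)
  then have "i \<in> V \<Longrightarrow> T c i i \<Longrightarrow>
      \<exists>k. has_value V (T z) k i \<and> (\<forall>m<k. \<exists>y>0. computes f (m # ns) y)" for i
  proof (induction i rule: wf_induct_rule)
    case (less i)
    show ?case
    proof (cases "zero_at V (T z) i")
      case True
      then show ?thesis by (intro exI[of _ 0]) auto
    next
      case False
      then obtain i' y u where *: "i' \<in> V" "T c i' i'" "T l i' i" "succ_at V (T z) i' i" "y \<in> V" "u \<in> V"
          "succ_at V (T z) u y" "computes_in V T z f (i' # vs) y"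
        using just[rule_format, OF less.prems] by blast
      then obtain k where k: "has_value V (T z) k i'" "\<forall>m<k. \<exists>y>0. computes f (m # ns) y"
        using less.IH[of i'] less.prems(1) by (auto simp: r_def)
      obtain m where m: "has_value V (T z) m y" "computes f (k # ns) m"
        using Mu.IH[OF *(8), of "k # ns"] k(1) *(1,5) Mu.prems(2,3) by auto
      \<comment> \<open>\<open>y\<close> has the predecessor \<open>u\<close>.\<close>
      then have "m > 0"
        using has_value_succ_at[OF m(1) *(7,6)] by blast
      with k m * show ?thesis
        by (intro exI[of _ "Suc k"]) (auto simp: less_Suc_eq)
    qed
  qed
  then obtain k where k: "has_value V (T z) k w" "\<forall>m<k. \<exists>y>0. computes f (m # ns) y"
    using c \<open>w \<in> V\<close> by blast
  obtain m where "has_value V (T z) m u" "computes f (k # ns) m"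
    using Mu.IH[OF u(3), of "k # ns"] k(1) u(1) Mu.prems(2-) by auto
  moreover from this have "m = 0"
    by (intro has_value_zero_at[OF _ u(2)])
  ultimately show ?case
    using k computes.Mu[of f k ns] by blast
qed

section \<open>Completeness in structures containing the numbers up to \<open>N\<close>\<close>

locale number_frame =
  fixes V :: "'v set" and T :: "'v \<Rightarrow> 'v \<Rightarrow> 'v \<Rightarrow> bool" and z :: 'v and num :: "nat \<Rightarrow> 'v" and N :: nat
  assumes num_in: "a \<le> N \<Longrightarrow> num a \<in> V"
    and num_inj: "a \<le> N \<Longrightarrow> b \<le> N \<Longrightarrow> num a = num b \<Longrightarrow> a = b"
    and numbers_only: "T c i y \<Longrightarrow> c \<in> V \<Longrightarrow> \<exists>a\<le>N. \<exists>b\<le>N. i = num a \<and> y = num b"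
    and code_exists: "R \<subseteq> {..N} \<times> {..N} \<Longrightarrow>
      \<exists>c\<in>V. \<forall>i y. T c i y \<longleftrightarrow> (\<exists>a b. (a, b) \<in> R \<and> i = num a \<and> y = num b)"
    and successor: "T z i y \<longleftrightarrow> (\<exists>a<N. i = num a \<and> y = num (Suc a))"
begin

lemma num_eq_iff: "a \<le> N \<Longrightarrow> b \<le> N \<Longrightarrow> num a = num b \<longleftrightarrow> a = b"
  using num_inj by blast

lemma zero_at_num_0: "zero_at V (T z) (num 0)"
  unfolding zero_at_def successor using num_eq_iff[of 0] by auto

lemma succ_at_num: "a < N \<Longrightarrow> succ_at V (T z) (num a) (num (Suc a))"
  unfolding succ_at_def successor by (auto simp: num_eq_iff)

lemma has_value_num: "a \<le> N \<Longrightarrow> has_value V (T z) a (num a)"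
proof (induction a)
  case 0
  then show ?case by (simp add: zero_at_num_0)
next
  case (Suc a)
  then show ?case using num_in[of a] succ_at_num[of a] by (auto intro!: bexI[of _ "num a"])
qed

text \<open>Since a code relates only numbers up to \<open>N\<close>, its relation is the image of a
  subset of \<open>{..N} \<times> {..N}\<close>; that subset with one more pair again has a code.
  This prolongs the history of a primitive recursion by one step.\<close>

lemma code_insert:
  assumes "c \<in> V" "a \<le> N" "b \<le> N"
  shows "\<exists>c'\<in>V. \<forall>i y. T c' i y \<longleftrightarrow> T c i y \<or> i = num a \<and> y = num b"
proof -
  let ?R = "insert (a, b) {(a, b). a \<le> N \<and> b \<le> N \<and> T c (num a) (num b)}"
  have *: "(\<exists>a' b'. (a', b') \<in> ?R \<and> i = num a' \<and> y = num b') \<longleftrightarrow> T c i y \<or> i = num a \<and> y = num b" for i y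
    using numbers_only[OF _ assms(1)] by (simp, metis)
  show ?thesis
    using code_exists[of ?R] assms(2,3) unfolding * by auto
qed

lemma computes_in_PrimRec_0:
  assumes "computes_in V T z f vs (num m)" "m \<le> N"
  shows "computes_in V T z (PrimRec f g) (num 0 # vs) (num m)"
proof -
  obtain c where "c \<in> V" "\<forall>i y. T c i y \<longleftrightarrow> (\<exists>a b. (a, b) \<in> {(0, m)} \<and> i = num a \<and> y = num b)"
    using code_exists[of "{(0, m)}"] assms(2) by auto
  then show ?thesis
    using assms by (auto simp: zero_at_num_0 intro!: bexI[of _ c])
qed

lemma computes_in_PrimRec_Suc:
  assumes "computes_in V T z (PrimRec f g) (num n # vs) (num y)"
    and "computes_in V T z g (num n # num y # vs) (num m)" "Suc n \<le> N" "y \<le> N" "m \<le> N"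
  shows "computes_in V T z (PrimRec f g) (num (Suc n) # vs) (num m)"
proof -
  let ?just = "\<lambda>c i y. zero_at V (T z) i \<and> computes_in V T z f vs y \<or>
    (\<exists>i'\<in>V. \<exists>y'\<in>V. T c i' y' \<and> succ_at V (T z) i' i \<and> computes_in V T z g (i' # y' # vs) y)"
  obtain c where c: "c \<in> V" "T c (num n) (num y)" and
    just: "\<forall>i\<in>V. \<forall>y\<in>V. T c i y \<longrightarrow> ?just c i y"
    using assms(1) by auto
  obtain c' where c': "c' \<in> V" "\<And>i y. T c' i y \<longleftrightarrow> T c i y \<or> i = num (Suc n) \<and> y = num m"
    using code_insert[OF c(1) assms(3,5)] by blast
  \<comment> \<open>The code occurs only positively in \<open>?just\<close>, so old pairs stay
    justified in the larger code; the new pair is justified by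
    \<open>(num n, num y)\<close>.\<close>
  have "?just c' i y'" if "i \<in> V" "y' \<in> V" "T c' i y'" for i y'
  proof (cases "T c i y'")
    case True
    then have "?just c i y'" using just that by blast
    then show ?thesis using c'(2) by blast
  next
    case False
    then have "i = num (Suc n)" "y' = num m" using c'(2) that by auto
    moreover have "num n \<in> V" "num y \<in> V" "T c' (num n) (num y)" "succ_at V (T z) (num n) (num (Suc n))"
      using c c' assms(3,4) by (auto intro: num_in succ_at_num)
    ultimately show ?thesis using assms(2) by blast
  qed
  moreover have "T c' (num (Suc n)) (num m)" using c' by simp
  ultimately show ?thesis using c'(1) by (simp, intro bexI[of _ c']) blast+
qed

lemma computes_in_Mu:
  assumes "computes_in V T z f (num n # vs) (num 0)" "n \<le> N"
    and "\<And>m. m < n \<Longrightarrow> \<exists>y>0. y \<le> N \<and> computes_in V T z f (num m # vs) (num y)"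
  shows "computes_in V T z (Mu f) vs (num n)"
proof -
  \<comment> \<open>The witnesses: \<open>l\<close> codes the usual order up to \<open>N\<close>,
    and \<open>c\<close> codes the set of numbers up to \<open>n\<close>, a set being represented by
    its diagonal relation.\<close>
  have "{(a, b). a < b \<and> b \<le> N} \<subseteq> {..N} \<times> {..N}" by auto
  from code_exists[OF this] obtain l where l: "l \<in> V"
      "\<And>i y. T l i y \<longleftrightarrow> (\<exists>a b. (a, b) \<in> {(a, b). a < b \<and> b \<le> N} \<and> i = num a \<and> y = num b)"
    by blast
  have "{(m, m) |m. m \<le> n} \<subseteq> {..N} \<times> {..N}" using assms(2) by auto
  from code_exists[OF this] obtain c where c: "c \<in> V"
      "\<And>i y. T c i y \<longleftrightarrow> (\<exists>a b. (a, b) \<in> {(m, m) |m. m \<le> n} \<and> i = num a \<and> y = num b)"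
    by blast
  have c_iff: "T c i y \<longleftrightarrow> (\<exists>m\<le>n. i = num m \<and> y = num m)" for i y
    unfolding c(2) by auto
  have l_iff: "T l (num a) (num b) \<longleftrightarrow> a < b" if "a \<le> N" "b \<le> N" for a b
    unfolding l(2) using that by (auto simp: num_eq_iff)
  have irr: "\<not> T l i i" for i
    unfolding l(2) by (auto simp: num_eq_iff)
  have tr: "T l i k" if "T l i j" "T l j k" for i j k
  proof -
    from that(1) obtain a b where "i = num a" "j = num b" "a < b" "b \<le> N"
      unfolding l(2) by auto
    moreover from that(2) obtain a' b' where "j = num a'" "k = num b'" "a' < b'" "b' \<le> N"
      unfolding l(2) by auto
    ultimately show ?thesis
      by (auto simp: num_eq_iff l_iff)
  qed
  have just: "zero_at V (T z) i \<or> (\<exists>i'\<in>V. T c i' i' \<and> T l i' i \<and> succ_at V (T z) i' i \<and>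
             (\<exists>y\<in>V. (\<exists>u\<in>V. succ_at V (T z) u y) \<and> computes_in V T z f (i' # vs) y))"
    if i: "T c i i" for i
  proof -
    obtain a where a: "a \<le> n" "i = num a" using i unfolding c_iff by blast
    show ?thesis
    proof (cases a)
      case 0
      then show ?thesis by (simp add: a zero_at_num_0)
    next
      case (Suc m)
      \<comment> \<open>Writing the positive value as a successor supplies the predecessor that the
        definition asks for.\<close>
      with a assms(3)[of m] obtain y' where y: "Suc y' \<le> N" "computes_in V T z f (num m # vs) (num (Suc y'))"
        by (metis Suc_le_lessD gr0_implies_Suc)
      have "num m \<in> V" "T c (num m) (num m)" "T l (num m) i" "succ_at V (T z) (num m) i"
        using a assms(2) Suc by (auto simp: c_iff l_iff intro: num_in succ_at_num exI[of _ m])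
      moreover have "num (Suc y') \<in> V" "num y' \<in> V" "succ_at V (T z) (num y') (num (Suc y'))"
        using y by (auto intro: num_in succ_at_num)
      ultimately show ?thesis using y by blast
    qed
  qed
  have "T c (num n) (num n)" "num 0 \<in> V" using num_in[of 0] by (auto simp: c_iff)
  show ?thesis
    unfolding computes_in.simps
    by (rule conjI, intro conjI bexI[OF _ \<open>num 0 \<in> V\<close>] zero_at_num_0 assms(1),
        rule bexI[OF _ l(1)], intro conjI, simp add: irr, meson tr,
        rule bexI[OF _ c(1)], intro conjI ballI impI just, fact)
qed

end

lemma eventually_list_all2:
  assumes "list_all2 (\<lambda>x y. eventually (\<lambda>n. P n x y) F) xs ys"
  shows "eventually (\<lambda>n. list_all2 (P n) xs ys) F"
  using assms by (induction rule: list_all2_induct) (auto intro: eventually_conj)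

text \<open>A computation involves finitely many numbers, so every large enough \<open>N\<close>
  accommodates it; "eventually" merges the bounds of the subcomputations. For this
  \<open>num\<close> must not depend on \<open>N\<close>.\<close>

lemma computes_in_complete:
  assumes frame: "\<And>N. number_frame (V N) (T N) (z N) num N"
  shows "computes f xs y \<Longrightarrow>
    \<forall>\<^sub>F N in sequentially. computes_in (V N) (T N) (z N) f (map num xs) (num y)"
proof (induction rule: computes.induct)
  case (Zero xs)
  show ?case by (simp add: number_frame.zero_at_num_0[OF frame])
next
  case (Succ x)
  show ?case using eventually_gt_at_top[of x]
    by eventually_elim (simp add: number_frame.succ_at_num[OF frame])
next
  case (Proj i xs)
  then show ?case by simp
next
  case (Comp xs gs ys f y)
  have "\<forall>\<^sub>F N in sequentially. list_all2 (\<lambda>g y. computes_in (V N) (T N) (z N) g (map num xs) (num y)) gs ys"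
    by (rule eventually_list_all2) (use Comp.IH(1) in \<open>auto elim: list_all2_mono\<close>)
  moreover have "\<forall>\<^sub>F N in sequentially. \<forall>y\<in>set ys. y \<le> N"
    by (simp add: eventually_ball_finite eventually_ge_at_top)
  ultimately show ?case using Comp.IH(2)
  proof eventually_elim
    case (elim N)
    then show ?case
      by (auto simp: list_all2_map1 list_all2_map2 number_frame.num_in[OF frame] intro!: exI[of _ "map num ys"])
  qed
next
  case (PrimRec_0 f xs y g)
  show ?case using PrimRec_0.IH eventually_ge_at_top[of y]
    by eventually_elim (use number_frame.computes_in_PrimRec_0[OF frame] in auto)
next
  case (PrimRec_Suc f g n xs y m)
  show ?case using PrimRec_Suc.IH eventually_ge_at_top[of "Suc n"] eventually_ge_at_top[of y]
      eventually_ge_at_top[of m]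
    by eventually_elim (use number_frame.computes_in_PrimRec_Suc[OF frame] in \<open>auto simp del: computes_in.simps\<close>)
next
  case (Mu f n xs)
  have "\<forall>\<^sub>F N in sequentially. \<exists>y>0. y \<le> N \<and> computes_in (V N) (T N) (z N) f (num m # map num xs) (num y)"
    if "m < n" for m
  proof -
    obtain y where y: "y > 0" "\<forall>\<^sub>F N in sequentially. computes_in (V N) (T N) (z N) f (map num (m # xs)) (num y)"
      using Mu.IH(2) \<open>m < n\<close> by blast
    from y(2) eventually_ge_at_top[of y] show ?thesis
      by eventually_elim (use y(1) in auto)
  qed
  then have "\<forall>\<^sub>F N in sequentially. \<forall>m\<in>{..<n}. \<exists>y>0. y \<le> N \<and>
      computes_in (V N) (T N) (z N) f (num m # map num xs) (num y)"
    by (intro eventually_ball_finite) auto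
  then show ?case using Mu.IH(1) eventually_ge_at_top[of n]
    by eventually_elim (rule number_frame.computes_in_Mu[OF frame], auto)
qed

section \<open>Translation into the language of graphs\<close>

definition dominating_fm :: fm where
  "dominating_fm = FEx 0 (FAll 1 (FDisj (FEq 0 1) (FAdj 0 1)))"

definition isolated_fm :: fm where
  "isolated_fm = FEx 0 (FAll 1 (FNeg (FAdj 0 1)))"

definition edgeless_fm :: fm where
  "edgeless_fm = FAll 0 (FAll 1 (FNeg (FAdj 0 1)))"

text \<open>Adjacency, read in the complement graph if there is a dominating vertex. It makes the
  sentences below invariant under complementation.\<close>

definition edge_fm :: "nat \<Rightarrow> nat \<Rightarrow> fm" where
  "edge_fm x y = FDisj (FConj dominating_fm (FConj (FNeg (FEq x y)) (FNeg (FAdj x y))))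
     (FConj (FNeg dominating_fm) (FAdj x y))"

text \<open>Throughout, the variables below 4 are parameters: 0 holds the code of the successor relation,
  and 1, 2, 3 the markers for the two kinds of vertices linking a pair of numbers and for the numbers.
  The argument \<open>k\<close> bounds the variables in use, so that those from \<open>k\<close> on are free for quantification.\<close>

definition rel_fm :: "nat \<Rightarrow> nat \<Rightarrow> nat \<Rightarrow> nat \<Rightarrow> fm" where
  "rel_fm k c i y = FEx k (FEx (Suc k)
     (FConj (edge_fm c k) (FConj (edge_fm i k) (FConj (edge_fm k (Suc k)) (FConj (edge_fm (Suc k) y)
     (FConj (edge_fm 1 k) (FConj (edge_fm 2 (Suc k)) (FConj (edge_fm 3 i) (edge_fm 3 y)))))))))"

definition zero_fm :: "nat \<Rightarrow> nat \<Rightarrow> fm" where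
  "zero_fm k v = FAll k (FNeg (rel_fm (Suc k) 0 k v))"

definition succ_fm :: "nat \<Rightarrow> nat \<Rightarrow> nat \<Rightarrow> fm" where
  "succ_fm k u v = FConj (rel_fm k 0 u v) (FAll k (FImp (rel_fm (Suc k) 0 k v) (FEq k u)))"

text \<open>Re-binding variable 4 keeps the recursion free of renaming, so that its code is primitive recursive
  in the code of the previous numeral.\<close>

primrec numeral_fm :: "nat \<Rightarrow> fm" where
  "numeral_fm 0 = zero_fm 6 4"
| "numeral_fm (Suc n) = FEx 5 (FConj (succ_fm 6 5 4) (FEx 4 (FConj (FEq 4 5) (numeral_fm n))))"

text \<open>The results of the inner programs are bound one after the other; \<open>ys\<close>
  accumulates the variables that hold them.\<close>

primrec comp_fm :: "(nat \<Rightarrow> nat list \<Rightarrow> nat \<Rightarrow> fm) list \<Rightarrow> (nat \<Rightarrow> nat list \<Rightarrow> nat \<Rightarrow> fm) \<Rightarrow>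
    nat \<Rightarrow> nat list \<Rightarrow> nat list \<Rightarrow> nat \<Rightarrow> fm" where
  "comp_fm [] F k xs ys w = F k ys w"
| "comp_fm (G # Gs) F k xs ys w =
     FEx k (FConj (G (Suc k) xs k) (comp_fm Gs F (Suc k) xs (ys @ [k]) w))"

abbreviation false_fm :: fm where
  "false_fm \<equiv> FEx 0 (FNeg (FEq 0 0))"

text \<open>Clause by clause the counterpart of \<open>computes_in\<close>, with variables
  \<open>xs\<close> for the arguments and \<open>w\<close> for the result.\<close>

primrec recf_fm :: "recf \<Rightarrow> nat \<Rightarrow> nat list \<Rightarrow> nat \<Rightarrow> fm" where
  "recf_fm Zero = (\<lambda>k xs w. zero_fm k w)"
| "recf_fm Succ = (\<lambda>k xs w. if length xs = 1 then succ_fm k (hd xs) w else false_fm)"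
| "recf_fm (Proj i) = (\<lambda>k xs w. if i < length xs then FEq (xs ! i) w else false_fm)"
| "recf_fm (Comp f gs) = (\<lambda>k xs w. comp_fm (map recf_fm gs) (recf_fm f) k xs [] w)"
| "recf_fm (PrimRec f g) = (\<lambda>k xs w. if xs = [] then false_fm else
     FEx k (FConj (rel_fm (k+1) k (hd xs) w)
       (FAll (k+1) (FAll (k+2) (FImp (rel_fm (k+3) k (k+1) (k+2))
         (FDisj (FConj (zero_fm (k+3) (k+1)) (recf_fm f (k+3) (tl xs) (k+2)))
           (FEx (k+3) (FEx (k+4) (FConj (rel_fm (k+5) k (k+3) (k+4))
             (FConj (succ_fm (k+5) (k+3) (k+1))
               (recf_fm g (k+5) ((k+3) # (k+4) # tl xs) (k+2))))))))))))"
| "recf_fm (Mu f) = (\<lambda>k xs w. FConj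
     (FEx k (FConj (zero_fm (k+1) k) (recf_fm f (k+1) (w # xs) k)))
     (FEx k (FConj (FAll (k+1) (FNeg (rel_fm (k+2) k (k+1) (k+1))))
       (FConj (FAll (k+1) (FAll (k+2) (FAll (k+3)
          (FImp (FConj (rel_fm (k+4) k (k+1) (k+2)) (rel_fm (k+4) k (k+2) (k+3)))
             (rel_fm (k+4) k (k+1) (k+3))))))
         (FEx (k+1) (FConj (rel_fm (k+2) (k+1) w w)
           (FAll (k+2) (FImp (rel_fm (k+3) (k+1) (k+2) (k+2))
             (FDisj (zero_fm (k+3) (k+2))
               (FEx (k+3) (FConj (rel_fm (k+4) (k+1) (k+3) (k+3))
                 (FConj (rel_fm (k+4) k (k+3) (k+2))
                 (FConj (succ_fm (k+4) (k+3) (k+2))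
                   (FEx (k+4) (FConj (FEx (k+5) (succ_fm (k+6) (k+5) (k+4)))
                     (recf_fm f (k+5) ((k+3) # xs) (k+4)))))))))))))))))"

section \<open>Meaning of the translated formulas\<close>

definition has_dominating :: "'v set \<Rightarrow> 'v set set \<Rightarrow> bool" where
  "has_dominating V E \<longleftrightarrow> (\<exists>v\<in>V. \<forall>u\<in>V. v = u \<or> {v, u} \<in> E)"

definition complete_edges :: "'v set \<Rightarrow> 'v set set" where
  "complete_edges V = {e. e \<subseteq> V \<and> card e = 2}"

definition normal_edges :: "'v set \<Rightarrow> 'v set set \<Rightarrow> 'v set set" where
  "normal_edges V E = (if has_dominating V E then complete_edges V - E else E)"

text \<open>The ordered pair of \<open>i\<close> and \<open>y\<close> is a path i - p - q - y,
  oriented by the markers \<open>A\<close> at \<open>p\<close> and \<open>B\<close> at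
  \<open>q\<close>; \<open>c\<close> contains the pair by being adjacent to
  \<open>p\<close>.\<close>

definition rel_in :: "'v set \<Rightarrow> 'v set set \<Rightarrow> 'v \<Rightarrow> 'v \<Rightarrow> 'v \<Rightarrow> 'v \<Rightarrow> 'v \<Rightarrow> 'v \<Rightarrow> bool" where
  "rel_in V E A B M c i y \<longleftrightarrow> (\<exists>p\<in>V. \<exists>q\<in>V. {c, p} \<in> E \<and> {i, p} \<in> E \<and> {p, q} \<in> E \<and> {q, y} \<in> E \<and>
     {A, p} \<in> E \<and> {B, q} \<in> E \<and> {M, i} \<in> E \<and> {M, y} \<in> E)"

text \<open>Assignments in \<open>sat\<close> may leave \<open>V\<close>; there the complement taken
  by \<open>edge_fm\<close> would differ from \<open>normal_edges\<close>.\<close>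

definition valuation :: "'v set \<Rightarrow> (nat \<Rightarrow> 'v) \<Rightarrow> bool" where
  "valuation V s \<longleftrightarrow> (\<forall>x. s x \<in> V)"

lemma valuation_upd: "valuation V s \<Longrightarrow> v \<in> V \<Longrightarrow> valuation V (s(x := v))"
  by (simp add: valuation_def)

lemma sat_dominating: "sat V E s dominating_fm \<longleftrightarrow> has_dominating V E"
  by (simp add: dominating_fm_def has_dominating_def)

lemma sat_edge:
  "s x \<in> V \<Longrightarrow> s y \<in> V \<Longrightarrow> sat V E s (edge_fm x y) \<longleftrightarrow> {s x, s y} \<in> normal_edges V E"
  by (auto simp: edge_fm_def sat_dominating normal_edges_def complete_edges_def card_2_iff)

abbreviation rel_at :: "'v set \<Rightarrow> 'v set set \<Rightarrow> (nat \<Rightarrow> 'v) \<Rightarrow> 'v \<Rightarrow> 'v \<Rightarrow> 'v \<Rightarrow> bool" where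
  "rel_at V E s \<equiv> rel_in V (normal_edges V E) (s 1) (s 2) (s 3)"

text \<open>The bounds by \<open>k\<close> prevent capture: binding \<open>k\<close> and
  \<open>Suc k\<close> changes neither the arguments nor the parameters 0 to 3.\<close>

lemma sat_rel:
  assumes "valuation V s" "4 \<le> k" "c < k" "i < k" "y < k"
  shows "sat V E s (rel_fm k c i y) \<longleftrightarrow> rel_at V E s (s c) (s i) (s y)"
proof -
  have "s x \<in> V" for x using assms by (simp add: valuation_def)
  then show ?thesis
    using assms(2-) by (simp add: rel_fm_def rel_in_def sat_edge)
qed

lemma sat_zero:
  assumes "valuation V s" "4 \<le> k" "v < k"
  shows "sat V E s (zero_fm k v) \<longleftrightarrow> zero_at V (rel_at V E s (s 0)) (s v)"
  using assms by (simp add: zero_fm_def zero_at_def sat_rel valuation_upd)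

lemma sat_succ:
  assumes "valuation V s" "4 \<le> k" "u < k" "v < k"
  shows "sat V E s (succ_fm k u v) \<longleftrightarrow> succ_at V (rel_at V E s (s 0)) (s u) (s v)"
  using assms by (simp add: succ_fm_def succ_at_def sat_rel valuation_upd)

lemma sat_numeral:
  assumes "valuation V s"
  shows "sat V E s (numeral_fm n) \<longleftrightarrow> has_value V (rel_at V E s (s 0)) n (s 4)"
  using assms by (induction n arbitrary: s) (auto simp: sat_zero sat_succ valuation_upd)

text \<open>Splits off one quantifier from a list of results, as \<open>comp_fm\<close>
  does.\<close>

lemma ex_list_all2_Cons:
  "(\<exists>us. set us \<subseteq> V \<and> list_all2 P (g # gs) us \<and> Q us) \<longleftrightarrow>
    (\<exists>u\<in>V. P g u \<and> (\<exists>us. set us \<subseteq> V \<and> list_all2 P gs us \<and> Q (u # us)))" (is "?L \<longleftrightarrow> ?R")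
proof
  assume ?L
  then obtain u us where "u \<in> V" "P g u" "set us \<subseteq> V" "list_all2 P gs us" "Q (u # us)"
    by (auto simp: list_all2_Cons1)
  then show ?R by blast
next
  assume ?R
  then obtain u us where "u \<in> V" "P g u" "set us \<subseteq> V" "list_all2 P gs us" "Q (u # us)" by blast
  then show ?L by (intro exI[of _ "u # us"]) simp
qed

text \<open>A predicate of its own, so that \<open>sat_comp\<close> can assume it of the subprograms
  inside the induction that proves it for all programs.\<close>

definition represented :: "'v set \<Rightarrow> 'v set set \<Rightarrow> recf \<Rightarrow> bool" where
  "represented V E f \<longleftrightarrow> (\<forall>s k xs w. valuation V s \<longrightarrow> 4 \<le> k \<longrightarrow> set xs \<subseteq> {..<k} \<longrightarrow> w < k \<longrightarrow>
     (sat V E s (recf_fm f k xs w) \<longleftrightarrow> computes_in V (rel_at V E s) (s 0) f (map s xs) (s w)))"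

lemma sat_represented:
  "represented V E f \<Longrightarrow> valuation V s \<Longrightarrow> 4 \<le> k \<Longrightarrow> set xs \<subseteq> {..<k} \<Longrightarrow> w < k \<Longrightarrow>
    sat V E s (recf_fm f k xs w) \<longleftrightarrow> computes_in V (rel_at V E s) (s 0) f (map s xs) (s w)"
  by (simp add: represented_def)

lemma sat_comp:
  assumes "valuation V s" "4 \<le> k" "set xs \<subseteq> {..<k}" "set ys \<subseteq> {..<k}" "w < k"
    and "\<forall>g\<in>set gs. represented V E g" "represented V E f"
  shows "sat V E s (comp_fm (map recf_fm gs) (recf_fm f) k xs ys w) \<longleftrightarrow>
    (\<exists>us. set us \<subseteq> V \<and> list_all2 (\<lambda>g u. computes_in V (rel_at V E s) (s 0) g (map s xs) u) gs us \<and>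
      computes_in V (rel_at V E s) (s 0) f (map s ys @ us) (s w))"
  using assms
proof (induction gs arbitrary: s k ys)
  case Nil
  then show ?case by (simp add: sat_represented)
next
  case (Cons g gs)
  let ?C = "\<lambda>g u. computes_in V (rel_at V E s) (s 0) g (map s xs) u"
  \<comment> \<open>As \<open>k\<close> is fresh, assigning it leaves the values of
    \<open>xs\<close> and \<open>ys\<close> unchanged.\<close>
  have nxs: "k \<notin> set xs" "k \<notin> set ys" using Cons.prems(3,4) by auto
  have sub: "set xs \<subseteq> {..<Suc k}" "set (ys @ [k]) \<subseteq> {..<Suc k}" using Cons.prems(3,4) by auto
  have "sat V E s (comp_fm (map recf_fm (g # gs)) (recf_fm f) k xs ys w) \<longleftrightarrow>
    (\<exists>u\<in>V. ?C g u \<and> (\<exists>us. set us \<subseteq> V \<and> list_all2 ?C gs us \<and>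
      computes_in V (rel_at V E s) (s 0) f (map s ys @ u # us) (s w)))"
    unfolding list.map comp_fm.simps sat.simps
  proof (intro bex_cong refl)
    fix u assume u: "u \<in> V"
    define t where "t = s(k := u)"
    have t: "valuation V t" "t 0 = s 0" "t 1 = s 1" "t 2 = s 2" "t 3 = s 3" "t w = s w" "t k = u"
        "map t xs = map s xs" "map t ys = map s ys"
      using Cons.prems(1,2,5) u nxs by (auto simp: t_def valuation_upd)
    have "sat V E t (recf_fm g (Suc k) xs k) \<longleftrightarrow> ?C g u"
      using sat_represented[of V E g t "Suc k" xs k] Cons.prems(2,6) sub
      by (simp add: t del: One_nat_def)
    moreover have "sat V E t (comp_fm (map recf_fm gs) (recf_fm f) (Suc k) xs (ys @ [k]) w) \<longleftrightarrow>
      (\<exists>us. set us \<subseteq> V \<and> list_all2 ?C gs us \<and>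
        computes_in V (rel_at V E s) (s 0) f (map s ys @ u # us) (s w))"
      using Cons.IH[of t "Suc k" "ys @ [k]", OF t(1) _ sub] Cons.prems(2,5,6,7)
      by (simp add: t del: One_nat_def)
    ultimately show "sat V E (s(k := u)) (recf_fm g (Suc k) xs k) \<and>
          sat V E (s(k := u)) (comp_fm (map recf_fm gs) (recf_fm f) (Suc k) xs (ys @ [k]) w) \<longleftrightarrow>
        ?C g u \<and> (\<exists>us. set us \<subseteq> V \<and> list_all2 ?C gs us \<and>
        computes_in V (rel_at V E s) (s 0) f (map s ys @ u # us) (s w))"
      unfolding t_def by (rule conj_cong)
  qed
  also have "\<dots> \<longleftrightarrow> (\<exists>us. set us \<subseteq> V \<and> list_all2 ?C (g # gs) us \<and>
      computes_in V (rel_at V E s) (s 0) f (map s ys @ us) (s w))"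
    by (rule ex_list_all2_Cons[symmetric])
  finally show ?case .
qed

lemma represented: "represented V E f"
proof (induction f)
  case Zero
  show ?case by (simp add: represented_def sat_zero)
next
  case Succ
  have "length xs = 1 \<Longrightarrow> \<exists>x. xs = [x]" for xs :: "nat list"
    by (simp add: length_Suc_conv)
  then show ?case by (fastforce simp: represented_def sat_succ)
next
  case (Proj i)
  show ?case by (auto simp: represented_def)
next
  case (Comp f gs)
  then show ?case
    by (auto simp: represented_def[of _ _ "Comp f gs"] sat_comp list_all2_map1)
next
  case (PrimRec f g)
  show ?case
    unfolding represented_def
  proof (intro allI impI)
    fix s k w and xs :: "nat list"
    assume s: "valuation V s" "4 \<le> (k::nat)" "set xs \<subseteq> {..<k}" "w < k"
    show "sat V E s (recf_fm (PrimRec f g) k xs w) \<longleftrightarrow>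
      computes_in V (rel_at V E s) (s 0) (PrimRec f g) (map s xs) (s w)"
    proof (cases xs)
      case Nil
      then show ?thesis by simp
    next
      case (Cons x xs')
      with s have x: "x < k" and xs': "set xs' \<subseteq> {..<k}" by auto
      then have sub: "set xs' \<subseteq> {..<k + j}" and nxs: "k \<le> j \<Longrightarrow> j \<notin> set xs'" for j by auto
      show ?thesis
        using s(1,2,4) x
        by (simp add: Cons sub nxs sat_represented[OF PrimRec.IH(1)] sat_represented[OF PrimRec.IH(2)]
            sat_rel sat_zero sat_succ valuation_upd)
    qed
  qed
next
  case (Mu f)
  show ?case
    unfolding represented_def
  proof (intro allI impI)
    fix s k w and xs :: "nat list"
    assume s: "valuation V s" "4 \<le> (k::nat)" "set xs \<subseteq> {..<k}" "w < k"
    have sub: "set xs \<subseteq> {..<k + j}" "set xs \<subseteq> {..<Suc k}" and nxs: "k \<le> j \<Longrightarrow> j \<notin> set xs" for j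
      using s(3) by auto
    show "sat V E s (recf_fm (Mu f) k xs w) \<longleftrightarrow>
      computes_in V (rel_at V E s) (s 0) (Mu f) (map s xs) (s w)"
      using s(1,2,4)
      by (simp add: sub nxs sat_represented[OF Mu.IH] sat_rel sat_zero sat_succ valuation_upd)
  qed
qed

lemmas sat_recf = sat_represented[OF represented]

section \<open>Free variables of the translated formulas\<close>

lemma fv_edge: "fv (edge_fm x y) = {x, y}"
  by (auto simp: edge_fm_def dominating_fm_def)

lemma fv_rel: "fv (rel_fm k c i y) \<subseteq> {c, i, y, 1, 2, 3}"
  by (auto simp: rel_fm_def fv_edge)

lemma fv_zero: "fv (zero_fm k v) \<subseteq> {v, 0, 1, 2, 3}"
  using fv_rel by (fastforce simp: zero_fm_def)

lemma fv_succ: "fv (succ_fm k u v) \<subseteq> {u, v, 0, 1, 2, 3}"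
  using fv_rel by (fastforce simp: succ_fm_def)

lemma fv_numeral: "fv (numeral_fm n) \<subseteq> {4, 0, 1, 2, 3}"
  using fv_zero[of 6 4] fv_succ[of 6 5 4] by (induction n) auto

lemma fv_comp:
  assumes "\<And>g k xs w. g \<in> set gs \<Longrightarrow> fv (recf_fm g k xs w) \<subseteq> set xs \<union> {w, 0, 1, 2, 3}"
    and "\<And>k xs w. fv (recf_fm f k xs w) \<subseteq> set xs \<union> {w, 0, 1, 2, 3}"
  shows "fv (comp_fm (map recf_fm gs) (recf_fm f) k xs ys w) \<subseteq> set xs \<union> set ys \<union> {w, 0, 1, 2, 3}"
  using assms(1)
proof (induction gs arbitrary: k ys)
  case Nil
  then show ?case using assms(2) by fastforce
next
  case (Cons g gs)
  have "fv (recf_fm g (Suc k) xs k) \<subseteq> set xs \<union> {k, 0, 1, 2, 3}"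
    using Cons.prems by simp
  moreover have "fv (comp_fm (map recf_fm gs) (recf_fm f) (Suc k) xs (ys @ [k]) w) \<subseteq>
      set xs \<union> set (ys @ [k]) \<union> {w, 0, 1, 2, 3}"
    using Cons.prems by (intro Cons.IH) simp
  ultimately show ?case by auto
qed

lemma fv_recf: "fv (recf_fm f k xs w) \<subseteq> set xs \<union> {w, 0, 1, 2, 3}"
proof (induction f arbitrary: k xs w)
  case Zero
  show ?case using fv_zero[of k w] by auto
next
  case Succ
  show ?case using fv_succ[of k "hd xs" w] by (cases xs) auto
next
  case (Proj i)
  then show ?case by simp
next
  case (Comp f gs)
  have "fv (comp_fm (map recf_fm gs) (recf_fm f) k xs [] w) \<subseteq> set xs \<union> set [] \<union> {w, 0, 1, 2, 3}"
    by (rule fv_comp; fact Comp.IH)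
  then show ?case by simp
next
  case (PrimRec f g)
  show ?case
  proof (cases xs)
    case (Cons x xs')
    show ?thesis
      using fv_rel[of "k+1" k x w] fv_rel[of "k+3" k "k+1" "k+2"] fv_rel[of "k+5" k "k+3" "k+4"]
        fv_zero[of "k+3" "k+1"] fv_succ[of "k+5" "k+3" "k+1"]
        PrimRec.IH(1)[of "k+3" xs' "k+2"] PrimRec.IH(2)[of "k+5" "(k+3) # (k+4) # xs'" "k+2"]
      by (auto simp: Cons)
  qed simp
next
  case (Mu f)
  show ?case
    using fv_zero[of "k+1" k] Mu.IH[of "k+1" "w # xs" k] fv_rel[of "k+2" k "k+1" "k+1"]
      fv_rel[of "k+4" k "k+1" "k+2"] fv_rel[of "k+4" k "k+2" "k+3"] fv_rel[of "k+4" k "k+1" "k+3"]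
      fv_rel[of "k+2" "k+1" w w] fv_rel[of "k+3" "k+1" "k+2" "k+2"] fv_zero[of "k+3" "k+2"]
      fv_rel[of "k+4" "k+1" "k+3" "k+3"] fv_rel[of "k+4" k "k+3" "k+2"] fv_succ[of "k+4" "k+3" "k+2"]
      fv_succ[of "k+6" "k+5" "k+4"] Mu.IH[of "k+5" "(k+3) # xs" "k+4"]
    by auto
qed

section \<open>Truth in a graph\<close>

lemma sat_cong_fv: "(\<And>x. x \<in> fv p \<Longrightarrow> s x = t x) \<Longrightarrow> sat V E s p \<longleftrightarrow> sat V E t p"
proof (induction p arbitrary: s t)
  case (FEx x p)
  have "sat V E (s(x := v)) p \<longleftrightarrow> sat V E (t(x := v)) p" for v
    using FEx.prems by (intro FEx.IH) auto
  then show ?case by simp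
next
  case (FAll x p)
  have "sat V E (s(x := v)) p \<longleftrightarrow> sat V E (t(x := v)) p" for v
    using FAll.prems by (intro FAll.IH) auto
  then show ?case by simp
next
  case (FConj p q)
  have "sat V E s p \<longleftrightarrow> sat V E t p" "sat V E s q \<longleftrightarrow> sat V E t q"
    using FConj.prems by (auto intro!: FConj.IH)
  then show ?case by simp
next
  case (FDisj p q)
  have "sat V E s p \<longleftrightarrow> sat V E t p" "sat V E s q \<longleftrightarrow> sat V E t q"
    using FDisj.prems by (auto intro!: FDisj.IH)
  then show ?case by simp
next
  case (FImp p q)
  have "sat V E s p \<longleftrightarrow> sat V E t p" "sat V E s q \<longleftrightarrow> sat V E t q"
    using FImp.prems by (auto intro!: FImp.IH)
  then show ?case by simp
next
  case (FNeg p)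
  have "sat V E s p \<longleftrightarrow> sat V E t p"
    using FNeg.prems by (intro FNeg.IH) simp
  then show ?case by simp
qed simp_all

lemma graph_sat_sentence: "sentence p \<Longrightarrow> graph_sat n E p \<longleftrightarrow> sat {1..n} E s p"
  unfolding graph_sat_def sentence_def using sat_cong_fv[of p] by (metis empty_iff)

lemma comp_upd: "e \<circ> s(x := v) = (e \<circ> s)(x := e v)"
  by auto

text \<open>Isomorphism invariance of truth, used to move a graph from the type
  \<open>vertex\<close> to \<open>{1..n}\<close>.\<close>

lemma sat_iso:
  assumes e: "bij_betw e V W" and E: "\<Union>E \<subseteq> V"
  shows "valuation V s \<Longrightarrow> sat V E s p \<longleftrightarrow> sat W ((`) e ` E) (e \<circ> s) p"
proof (induction p arbitrary: s)
  case (FEq x y)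
  then show ?case
    using inj_on_eq_iff[OF bij_betw_imp_inj_on[OF e]] by (simp add: valuation_def)
next
  case (FAdj x y)
  then have "{s x, s y} \<subseteq> V" by (simp add: valuation_def)
  \<comment> \<open>All edges are subsets of \<open>V\<close>, on which taking images is injective,
    so no adjacency is created.\<close>
  moreover have "inj_on ((`) e) (Pow V)"
    using e by (simp add: bij_betw_imp_inj_on inj_on_image_Pow)
  ultimately have "e ` {s x, s y} \<in> (`) e ` E \<longleftrightarrow> {s x, s y} \<in> E"
    using E by (intro inj_on_image_mem_iff[of _ "Pow V"]) auto
  then show ?case by simp
next
  case (FEx x p)
  have "sat V E (s(x := v)) p \<longleftrightarrow> sat W ((`) e ` E) ((e \<circ> s)(x := e v)) p" if "v \<in> V" for v
    using FEx.IH[OF valuation_upd[OF FEx.prems that, of x]] unfolding comp_upd .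
  then show ?case by (simp add: comp_def flip: bij_betw_imp_surj_on[OF e])
next
  case (FAll x p)
  have "sat V E (s(x := v)) p \<longleftrightarrow> sat W ((`) e ` E) ((e \<circ> s)(x := e v)) p" if "v \<in> V" for v
    using FAll.IH[OF valuation_upd[OF FAll.prems that, of x]] unfolding comp_upd .
  then show ?case by (simp add: comp_def flip: bij_betw_imp_surj_on[OF e])
qed simp_all

section \<open>Edgeless graphs\<close>

primrec qdepth :: "fm \<Rightarrow> nat" where
  "qdepth (FEq x y) = 0"
| "qdepth (FAdj x y) = 0"
| "qdepth (FNeg p) = qdepth p"
| "qdepth (FConj p q) = max (qdepth p) (qdepth q)"
| "qdepth (FDisj p q) = max (qdepth p) (qdepth q)"
| "qdepth (FImp p q) = max (qdepth p) (qdepth q)"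
| "qdepth (FEx x p) = Suc (qdepth p)"
| "qdepth (FAll x p) = Suc (qdepth p)"

definition same_pattern :: "nat set \<Rightarrow> (nat \<Rightarrow> 'v) \<Rightarrow> (nat \<Rightarrow> 'w) \<Rightarrow> bool" where
  "same_pattern X s t \<longleftrightarrow> (\<forall>x\<in>X. \<forall>y\<in>X. s x = s y \<longleftrightarrow> t x = t y)"

lemma same_pattern_sym: "same_pattern X s t \<Longrightarrow> same_pattern X t s"
  unfolding same_pattern_def by blast

lemma same_pattern_extend:
  assumes "same_pattern X s t" "t ` X \<subseteq> W" "finite X" "finite W" "card X < card W"
  shows "\<exists>w\<in>W. same_pattern (insert x X) (s(x := v)) (t(x := w))"
proof (cases "\<exists>y\<in>X - {x}. s y = v")
  case True
  then obtain y where "y \<in> X - {x}" "s y = v" by blast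
  then show ?thesis
    using assms(1,2) by (intro bexI[of _ "t y"]) (auto simp: same_pattern_def)
next
  case False
  have "card (t ` X) < card W"
    using card_image_le[OF assms(3)] assms(5) by (rule le_less_trans)
  then obtain w where "w \<in> W" "w \<notin> t ` X"
    using assms(2) by (metis less_irrefl subsetI subset_antisym)
  then show ?thesis
    using False assms(1) by (intro bexI[of _ w]) (auto simp: same_pattern_def)
qed

text \<open>A quantifier uses up one unit of depth and adds at most one variable to
  \<open>X\<close>, so the bound on \<open>card X + qdepth p\<close> persists and there is always
  room for a fresh answer.\<close>

lemma sat_edgeless_cong:
  assumes "finite V" "finite W"
  shows "finite X \<Longrightarrow> fv p \<subseteq> X \<Longrightarrow> card X + qdepth p \<le> card V \<Longrightarrow> card X + qdepth p \<le> card W \<Longrightarrow>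
    s ` X \<subseteq> V \<Longrightarrow> t ` X \<subseteq> W \<Longrightarrow> same_pattern X s t \<Longrightarrow> sat V {} s p \<longleftrightarrow> sat W {} t p"
proof (induction p arbitrary: X s t)
  case (FEq x y)
  then show ?case by (auto simp: same_pattern_def)
next
  case (FEx x p)
  let ?X = "insert x X"
  have c: "card ?X \<le> Suc (card X)" using FEx.prems(1) by (simp add: card_insert_if)
  have IH: "sat V {} (s(x := v)) p \<longleftrightarrow> sat W {} (t(x := w)) p"
    if "v \<in> V" "w \<in> W" "same_pattern ?X (s(x := v)) (t(x := w))" for v w
    using FEx.prems c that by (intro FEx.IH[of ?X]) (auto simp: fun_upd_def)
  have "\<exists>w\<in>W. same_pattern ?X (s(x := v)) (t(x := w))" for v
    using FEx.prems assms by (intro same_pattern_extend) auto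
  moreover have "\<exists>v\<in>V. same_pattern ?X (t(x := w)) (s(x := v))" for w
    using FEx.prems assms by (intro same_pattern_extend same_pattern_sym[of _ s]) auto
  ultimately show ?case using IH same_pattern_sym unfolding sat.simps by metis
next
  case (FAll x p)
  let ?X = "insert x X"
  have c: "card ?X \<le> Suc (card X)" using FAll.prems(1) by (simp add: card_insert_if)
  have IH: "sat V {} (s(x := v)) p \<longleftrightarrow> sat W {} (t(x := w)) p"
    if "v \<in> V" "w \<in> W" "same_pattern ?X (s(x := v)) (t(x := w))" for v w
    using FAll.prems c that by (intro FAll.IH[of ?X]) (auto simp: fun_upd_def)
  have "\<exists>w\<in>W. same_pattern ?X (s(x := v)) (t(x := w))" for v
    using FAll.prems assms by (intro same_pattern_extend) auto
  moreover have "\<exists>v\<in>V. same_pattern ?X (t(x := w)) (s(x := v))" for w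
    using FAll.prems assms by (intro same_pattern_extend same_pattern_sym[of _ s]) auto
  ultimately show ?case using IH same_pattern_sym unfolding sat.simps by metis
next
  case (FConj p q)
  have "sat V {} s p \<longleftrightarrow> sat W {} t p" "sat V {} s q \<longleftrightarrow> sat W {} t q"
    using FConj.prems by (intro FConj.IH[of X]; simp)+
  then show ?case by simp
next
  case (FDisj p q)
  have "sat V {} s p \<longleftrightarrow> sat W {} t p" "sat V {} s q \<longleftrightarrow> sat W {} t q"
    using FDisj.prems by (intro FDisj.IH[of X]; simp)+
  then show ?case by simp
next
  case (FImp p q)
  have "sat V {} s p \<longleftrightarrow> sat W {} t p" "sat V {} s q \<longleftrightarrow> sat W {} t q"
    using FImp.prems by (intro FImp.IH[of X]; simp)+
  then show ?case by simp
next
  case (FNeg p)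
  have "sat V {} s p \<longleftrightarrow> sat W {} t p"
    using FNeg.prems by (intro FNeg.IH[of X]) auto
  then show ?case by simp
qed simp

lemma graph_sat_edgeless_eventually_const:
  assumes "sentence q" "qdepth q \<le> m" "qdepth q \<le> n"
  shows "graph_sat m {} q \<longleftrightarrow> graph_sat n {} q"
  \<comment> \<open>The value 0 is not a vertex, but a sentence is compared over the empty set of
    variables.\<close>
  unfolding graph_sat_sentence[OF assms(1), where s = "\<lambda>_. 0"]
  using assms by (intro sat_edgeless_cong[where X = "{}"]) (auto simp: sentence_def same_pattern_def)

text \<open>The random graph is then deterministic, and the truth of \<open>q\<close> in it is
  constant from the quantifier depth of \<open>q\<close> on.\<close>

lemma obeys_zero_one_law_if_only_edgeless:
  assumes "\<And>n. n > 0 \<Longrightarrow> graphs_sat n p = {{}}"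
  shows "obeys_zero_one_law p"
  unfolding obeys_zero_one_law_def
proof (intro conjI allI impI)
  have "{0<..} \<subseteq> spectrum p"
    using assms by (auto simp: spectrum_def)
  then show "infinite (spectrum p)"
    using infinite_Ioi infinite_super by blast
next
  fix q assume q: "sentence q"
  let ?c = "of_bool (graph_sat (qdepth q) {} q) :: real"
  \<comment> \<open>\<open>Suc\<close> also makes \<open>n\<close> positive, as the assumption
    requires.\<close>
  have "measure_pmf.prob (cond_graph n p) {E. graph_sat n E q} = ?c" if "n \<ge> Suc (qdepth q)" for n
  proof -
    have "graph_sat n {} q \<longleftrightarrow> graph_sat (qdepth q) {} q"
      using that by (intro graph_sat_edgeless_eventually_const[OF q]) auto
    then show ?thesis
      using that assms[of n] by (simp add: cond_graph_def measure_pmf_of_set)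
  qed
  then have "(\<lambda>n. measure_pmf.prob (cond_graph n p) {E. graph_sat n E q}) \<longlonglongrightarrow> ?c"
    by (intro tendsto_eventually eventually_sequentiallyI[of "Suc (qdepth q)"])
  then have "((\<lambda>n. measure_pmf.prob (cond_graph n p) {E. graph_sat n E q}) \<longlongrightarrow> ?c)
      (inf sequentially (principal (spectrum p)))"
    by (rule tendsto_mono[rotated]) simp
  then show "\<exists>c\<in>{0, 1}. ((\<lambda>n. measure_pmf.prob (cond_graph n p) {E. graph_sat n E q}) \<longlongrightarrow> c)
      (inf sequentially (principal (spectrum p)))"
    by (intro bexI[of _ ?c]) auto
qed

section \<open>A graph in which every relation has a code\<close>

text \<open>\<open>Source a b\<close> and \<open>Target a b\<close> are the inner vertices of the
  path for the pair \<open>(a, b)\<close>, and \<open>Code r\<close> is joined to the sources of the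
  pairs in \<open>r\<close>. The vertices \<open>Pad k\<close> are isolated and make the graph as
  large as desired.\<close>

datatype vertex =
    Num nat
  | Source nat nat
  | Target nat nat
  | Code "(nat \<times> nat) set"
  | Source_Mark
  | Target_Mark
  | Num_Mark
  | Pad nat

definition frame_edges :: "nat \<Rightarrow> vertex set set" where
  "frame_edges N =
     (\<Union>a\<in>{..N}. \<Union>b\<in>{..N}. {{Num a, Source a b}, {Source a b, Target a b}, {Target a b, Num b},
        {Source_Mark, Source a b}, {Target_Mark, Target a b}}) \<union>
     (\<Union>a\<in>{..N}. {{Num_Mark, Num a}}) \<union>
     (\<Union>r\<in>Pow ({..N} \<times> {..N}). \<Union>(a, b)\<in>r. {{Code r, Source a b}})"

definition frame_vertices :: "nat \<Rightarrow> nat \<Rightarrow> vertex set" where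
  "frame_vertices N m = Num ` {..N} \<union> (\<lambda>(a, b). Source a b) ` ({..N} \<times> {..N}) \<union>
     (\<lambda>(a, b). Target a b) ` ({..N} \<times> {..N}) \<union> Code ` Pow ({..N} \<times> {..N}) \<union>
     {Source_Mark, Target_Mark, Num_Mark} \<union> Pad ` {..m}"

lemma finite_frame_vertices: "finite (frame_vertices N m)"
  by (auto simp: frame_vertices_def)

lemma card_frame_vertices: "m < card (frame_vertices N m)"
proof -
  have "card (Pad ` {..m}) = Suc m"
    by (simp add: card_image inj_on_def)
  moreover have "card (Pad ` {..m}) \<le> card (frame_vertices N m)"
    by (intro card_mono finite_frame_vertices) (auto simp: frame_vertices_def)
  ultimately show ?thesis by simp
qed

lemma frame_edges_complete: "frame_edges N \<subseteq> complete_edges (frame_vertices N m)"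
  by (auto simp: frame_edges_def complete_edges_def frame_vertices_def)

text \<open>The neighbours of the markers reveal the kind of a vertex; among vertices of known kinds
  the labels decide adjacency.\<close>

lemma frame_edge_simps:
  "{Source_Mark, p} \<in> frame_edges N \<longleftrightarrow> (\<exists>a\<le>N. \<exists>b\<le>N. p = Source a b)"
  "{Target_Mark, q} \<in> frame_edges N \<longleftrightarrow> (\<exists>a\<le>N. \<exists>b\<le>N. q = Target a b)"
  "{Num_Mark, i} \<in> frame_edges N \<longleftrightarrow> (\<exists>a\<le>N. i = Num a)"
  "{Source a b, Target c d} \<in> frame_edges N \<longleftrightarrow> a = c \<and> b = d \<and> a \<le> N \<and> b \<le> N"
  "{Num c, Source a b} \<in> frame_edges N \<longleftrightarrow> c = a \<and> a \<le> N \<and> b \<le> N"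
  "{Target a b, Num c} \<in> frame_edges N \<longleftrightarrow> c = b \<and> a \<le> N \<and> b \<le> N"
  "{Code r, Source a b} \<in> frame_edges N \<longleftrightarrow> r \<subseteq> {..N} \<times> {..N} \<and> (a, b) \<in> r"
  by (auto simp: frame_edges_def doubleton_eq_iff)

lemma pad_isolated: "{Pad k, v} \<notin> frame_edges N"
  by (auto simp: frame_edges_def doubleton_eq_iff)

definition frame_rel :: "nat \<Rightarrow> nat \<Rightarrow> vertex \<Rightarrow> vertex \<Rightarrow> vertex \<Rightarrow> bool" where
  "frame_rel N m = rel_in (frame_vertices N m) (frame_edges N) Source_Mark Target_Mark Num_Mark"

lemma frame_rel_Code:
  assumes "r \<subseteq> {..N} \<times> {..N}"
  shows "frame_rel N m (Code r) i y \<longleftrightarrow> (\<exists>a b. (a, b) \<in> r \<and> i = Num a \<and> y = Num b)" (is "?L \<longleftrightarrow> ?R")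
proof
  assume ?L
  then show ?R by (auto simp: frame_rel_def rel_in_def frame_edge_simps)
next
  assume ?R
  then obtain a b where *: "(a, b) \<in> r" "i = Num a" "y = Num b" by blast
  with assms have "a \<le> N" "b \<le> N" by auto
  with assms * show ?L
    unfolding frame_rel_def rel_in_def
    by (intro bexI[of _ "Source a b"] bexI[of _ "Target a b"])
      (auto simp: frame_edge_simps frame_vertices_def)
qed

lemma number_frame_vertices:
  "number_frame (frame_vertices N m) (frame_rel N m) (Code {(a, Suc a) |a. a < N}) Num N"
proof
  fix R :: "(nat \<times> nat) set" assume R: "R \<subseteq> {..N} \<times> {..N}"
  then have "Code R \<in> frame_vertices N m"
    by (simp add: frame_vertices_def)
  with frame_rel_Code[OF R] show "\<exists>c\<in>frame_vertices N m. \<forall>i y. frame_rel N m c i y \<longleftrightarrow>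
      (\<exists>a b. (a, b) \<in> R \<and> i = Num a \<and> y = Num b)"
    by blast
next
  fix i y
  have "{(a, Suc a) |a. a < N} \<subseteq> {..N} \<times> {..N}" by auto
  then show "frame_rel N m (Code {(a, Suc a) |a. a < N}) i y \<longleftrightarrow> (\<exists>a<N. i = Num a \<and> y = Num (Suc a))"
    by (auto simp: frame_rel_Code)
qed (auto simp: frame_vertices_def frame_rel_def rel_in_def frame_edge_simps)

section \<open>Halting as a graph property\<close>

text \<open>Variable 4 holds the input and 5 the result, so 6 is the first free one.\<close>

definition search_fm :: "recf \<Rightarrow> fm" where
  "search_fm f = FEx 5 (recf_fm f 6 [4] 5)"

text \<open>The input is fixed by a conjunct on variable 4 rather than by substitution, so that
  \<open>p\<close> remains an intact subformula and the code is easily computed from that of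
  \<open>p\<close>.\<close>

definition instance_fm :: "nat \<Rightarrow> fm \<Rightarrow> fm" where
  "instance_fm x p = FEx 0 (FEx 1 (FEx 2 (FEx 3 (FEx 4 (FConj (numeral_fm x) p)))))"

text \<open>The first disjunct provides models of every size, whether or not the second has
  any.\<close>

definition diagonal_fm :: "nat \<Rightarrow> fm \<Rightarrow> fm" where
  "diagonal_fm x p = FDisj edgeless_fm (FConj (FDisj dominating_fm isolated_fm) (instance_fm x p))"

definition shows_halting :: "'v set \<Rightarrow> 'v set set \<Rightarrow> recf \<Rightarrow> nat \<Rightarrow> bool" where
  "shows_halting V E f x \<longleftrightarrow> (\<exists>z\<in>V. \<exists>A\<in>V. \<exists>B\<in>V. \<exists>M\<in>V. \<exists>v\<in>V.
     has_value V (rel_in V E A B M z) x v \<and> (\<exists>w\<in>V. computes_in V (rel_in V E A B M) z f [v] w))"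

lemma sat_instance_search:
  assumes "valuation V s"
  shows "sat V E s (instance_fm x (search_fm f)) \<longleftrightarrow> shows_halting V (normal_edges V E) f x"
  using assms
  by (simp add: instance_fm_def search_fm_def shows_halting_def sat_numeral sat_recf valuation_upd)

lemma sentence_diagonal: "sentence (diagonal_fm x (search_fm f))"
proof -
  have "fv (recf_fm f 6 [4] 5) \<subseteq> {4, 5, 0, 1, 2, 3}"
    using fv_recf[of f 6 "[4]" 5] by auto
  then have "fv (search_fm f) \<subseteq> {4, 0, 1, 2, 3}"
    by (auto simp: search_fm_def)
  with fv_numeral[of x] show ?thesis
    by (auto simp: sentence_def diagonal_fm_def instance_fm_def edgeless_fm_def dominating_fm_def isolated_fm_def)
qed

lemma shows_halting_sound:
  assumes "finite V" "shows_halting V E f x"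
  shows "\<exists>y. computes f [x] y"
  using assms(2) computes_in_sound[OF assms(1), of _ _ f "[_]" _ "[x]"]
  unfolding shows_halting_def by fastforce

definition has_isolated :: "'v set \<Rightarrow> 'v set set \<Rightarrow> bool" where
  "has_isolated V E \<longleftrightarrow> (\<exists>v\<in>V. \<forall>u\<in>V. {v, u} \<notin> E)"

lemma sat_isolated: "sat V E s isolated_fm \<longleftrightarrow> has_isolated V E"
  by (simp add: isolated_fm_def has_isolated_def)

text \<open>Two vertices are needed: in a one-vertex graph the vertex is both isolated and
  dominating.\<close>

lemma not_isolated_and_dominating:
  assumes "has_isolated V E" "has_dominating V E" "finite V" "2 \<le> card V"
  shows False
proof -
  obtain v where v: "v \<in> V" "\<And>u. u \<in> V \<Longrightarrow> {v, u} \<notin> E"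
    using assms(1) unfolding has_isolated_def by blast
  obtain d where d: "d \<in> V" "\<And>u. u \<in> V \<Longrightarrow> d = u \<or> {d, u} \<in> E"
    using assms(2) unfolding has_dominating_def by blast
  have "d = v"
    using v(2)[OF d(1)] d(2)[OF v(1)] by (auto simp: insert_commute)
  have "V \<noteq> {v}"
    using assms(4) by auto
  then obtain u where "u \<in> V" "u \<noteq> v"
    using v(1) by blast
  with v d \<open>d = v\<close> show False by blast
qed

text \<open>A frame with large \<open>N\<close> contains a certificate. Its pads bring the size
  above \<open>k\<close> and give an isolated vertex, so there is no dominating one and
  \<open>normal_edges\<close> leaves the graph as it is.\<close>

lemma shows_halting_complete:
  assumes "computes f [x] y"
  shows "\<exists>n>k. \<exists>E\<in>graphs_on n. has_isolated {1..n} E \<and> shows_halting {1..n} (normal_edges {1..n} E) f x"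
proof -
  let ?V = "\<lambda>N. frame_vertices N k" and ?z = "\<lambda>N. Code {(a, Suc a) |a. a < N}"
  have "\<forall>\<^sub>F N in sequentially. computes_in (?V N) (frame_rel N k) (?z N) f [Num x] (Num y)"
    using computes_in_complete[where V = ?V and z = ?z, OF number_frame_vertices assms] by simp
  then have "\<forall>\<^sub>F N in sequentially. computes_in (?V N) (frame_rel N k) (?z N) f [Num x] (Num y) \<and> x \<le> N \<and> y \<le> N"
    by (intro eventually_conj eventually_ge_at_top)
  then obtain N where N: "computes_in (?V N) (frame_rel N k) (?z N) f [Num x] (Num y)" "x \<le> N" "y \<le> N"
    by (auto simp: eventually_sequentially)
  define V where "V = ?V N"
  define n where "n = card V"
  have fin: "finite V" by (simp add: V_def finite_frame_vertices)
  have "k < n" using card_frame_vertices by (simp add: n_def V_def)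
  have "{Source_Mark, Target_Mark} \<subseteq> V" by (simp add: V_def frame_vertices_def)
  from card_mono[OF fin this] have "2 \<le> n" by (simp add: n_def)
  have iso: "has_isolated V (frame_edges N)"
    unfolding has_isolated_def V_def
    by (intro bexI[of _ "Pad 0"]) (auto simp: pad_isolated frame_vertices_def)
  then have "\<not> has_dominating V (frame_edges N)"
    using not_isolated_and_dominating[OF _ _ fin] \<open>2 \<le> n\<close> unfolding n_def by blast
  then have norm: "normal_edges V (frame_edges N) = frame_edges N"
    by (simp add: normal_edges_def)
  have val_x: "has_value V (frame_rel N k (?z N)) x (Num x)"
    using number_frame.has_value_num[OF number_frame_vertices N(2)] by (simp add: V_def)
  have "shows_halting V (frame_edges N) f x"
  proof -
    have V: "?z N \<in> V" "Source_Mark \<in> V" "Target_Mark \<in> V" "Num_Mark \<in> V" "Num x \<in> V" "Num y \<in> V"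
      using N(2,3) by (auto simp: V_def frame_vertices_def image_iff)
    have rel: "rel_in V (frame_edges N) Source_Mark Target_Mark Num_Mark = frame_rel N k"
      by (simp add: frame_rel_def V_def)
    have comp: "computes_in V (frame_rel N k) (?z N) f [Num x] (Num y)"
      using N(1) by (simp add: V_def)
    show ?thesis
      unfolding shows_halting_def
      by (rule bexI[OF _ V(1)], rule bexI[OF _ V(2)], rule bexI[OF _ V(3)],
          rule bexI[OF _ V(4)], rule bexI[OF _ V(5)], unfold rel,
          intro conjI val_x, rule bexI[OF _ V(6)], rule comp)
  qed
  moreover have val: "valuation V (\<lambda>_. Num_Mark)"
    by (simp add: valuation_def V_def frame_vertices_def)
  \<comment> \<open>Both properties are phrased as the truth of a formula, so that
    \<open>sat_iso\<close> carries them over to \<open>{1..n}\<close>.\<close>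
  ultimately have sat_V: "sat V (frame_edges N) (\<lambda>_. Num_Mark) (FConj isolated_fm (instance_fm x (search_fm f)))"
    using iso sat_instance_search[OF val, of "frame_edges N" x f]
    by (simp only: norm sat.simps sat_isolated)
  have "card V = card {1..n}" by (simp add: n_def)
  from finite_same_card_bij[OF fin finite_atLeastAtMost this] obtain e where e: "bij_betw e V {1..n}" ..
  define E where "E = (`) e ` frame_edges N"
  have sub: "frame_edges N \<subseteq> complete_edges V"
    using frame_edges_complete by (simp add: V_def)
  from val have val': "valuation {1..n} (e \<circ> (\<lambda>_. Num_Mark))"
    using bij_betw_apply[OF e] by (simp add: valuation_def)
  have "\<Union>(frame_edges N) \<subseteq> V"
    using sub by (auto simp: complete_edges_def)
  from sat_iso[OF e this val] sat_V
  have "sat {1..n} E (e \<circ> (\<lambda>_. Num_Mark)) (FConj isolated_fm (instance_fm x (search_fm f)))"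
    by (simp only: E_def)
  then have "has_isolated {1..n} E" "shows_halting {1..n} (normal_edges {1..n} E) f x"
    using sat_instance_search[OF val'] by (simp_all add: sat_isolated)
  moreover have "E \<in> graphs_on n"
  proof -
    have "e ` d \<subseteq> {1..n} \<and> card (e ` d) = 2" if "d \<in> frame_edges N" for d
    proof -
      have "d \<subseteq> V" "card d = 2" using sub that by (auto simp: complete_edges_def)
      then show ?thesis
        using e by (metis bij_betw_def card_image image_mono inj_on_subset)
    qed
    then show ?thesis by (auto simp: E_def graphs_on_def)
  qed
  ultimately show ?thesis using \<open>k < n\<close> by blast
qed

section \<open>The zero-one law and halting\<close>

lemma sat_edgeless:
  assumes "E \<subseteq> complete_edges V"
  shows "sat V E s edgeless_fm \<longleftrightarrow> E = {}"
proof -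
  have False if "\<forall>u\<in>V. \<forall>v\<in>V. {u, v} \<notin> E" "e \<in> E" for e
  proof -
    from that(2) assms obtain u v where "e = {u, v}" "e \<subseteq> V"
      by (auto simp: complete_edges_def card_2_iff)
    with that show False by auto
  qed
  then show ?thesis by (auto simp: edgeless_fm_def)
qed

lemma graphs_on_eq: "graphs_on n = Pow (complete_edges {1..n})"
  by (simp add: graphs_on_def complete_edges_def)

lemma graphs_sat_diagonal:
  assumes "n > 0"
  shows "graphs_sat n (diagonal_fm x (search_fm f)) = {E \<in> graphs_on n. E = {} \<or>
    (has_dominating {1..n} E \<or> has_isolated {1..n} E) \<and> shows_halting {1..n} (normal_edges {1..n} E) f x}"
proof -
  have "valuation {1..n} (\<lambda>_. 1)"
    using assms by (simp add: valuation_def)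
  from sat_instance_search[OF this] show ?thesis
    unfolding graphs_sat_def graph_sat_sentence[OF sentence_diagonal, where s = "\<lambda>_. 1"]
    by (auto simp: diagonal_fm_def sat_dominating sat_isolated sat_edgeless graphs_on_eq simp del: One_nat_def)
qed

lemma not_halting_obeys:
  assumes "\<nexists>y. computes f [x] y"
  shows "obeys_zero_one_law (diagonal_fm x (search_fm f))"
proof (rule obeys_zero_one_law_if_only_edgeless)
  fix n :: nat assume "n > 0"
  have "\<not> shows_halting {1..n} E f x" for E
    using shows_halting_sound[of "{1..n}"] assms by blast
  then show "graphs_sat n (diagonal_fm x (search_fm f)) = {{}}"
    using \<open>n > 0\<close> by (auto simp: graphs_sat_diagonal graphs_on_def)
qed

lemma has_dominating_complement:
  assumes "has_isolated V E"
  shows "has_dominating V (complete_edges V - E)"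
proof -
  obtain v where v: "v \<in> V" "\<And>u. u \<in> V \<Longrightarrow> {v, u} \<notin> E"
    using assms by (auto simp: has_isolated_def)
  then have "v = u \<or> {v, u} \<in> complete_edges V - E" if "u \<in> V" for u
    using that by (auto simp: complete_edges_def card_insert_if)
  with v(1) show ?thesis by (auto simp: has_dominating_def)
qed

lemma has_isolated_complement:
  assumes "has_dominating V E"
  shows "has_isolated V (complete_edges V - E)"
proof -
  obtain v where v: "v \<in> V" "\<And>u. u \<in> V \<Longrightarrow> v = u \<or> {v, u} \<in> E"
    using assms by (auto simp: has_dominating_def)
  then have "{v, u} \<notin> complete_edges V - E" if "u \<in> V" for u
    using v(2)[OF that] by (auto simp: complete_edges_def)
  with v(1) show ?thesis by (auto simp: has_isolated_def)
qed

text \<open>Complementation pairs the certified graphs with an isolated vertex (\<open>I\<close>)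
  and those with a dominating one (\<open>D\<close>). With \<open>d = card D > 0\<close> there are
  \<open>2 * d\<close> or \<open>2 * d + 1\<close> models, the possible extra one being edgeless,
  and exactly \<open>d\<close> of them have a dominating vertex.\<close>

lemma prob_dominating_bounds:
  assumes n: "2 \<le> n" and E0: "E0 \<in> graphs_on n" "has_isolated {1..n} E0"
      "shows_halting {1..n} (normal_edges {1..n} E0) f x"
    and p: "p = diagonal_fm x (search_fm f)"
  shows "measure_pmf.prob (cond_graph n p) {E. graph_sat n E dominating_fm} \<in> {1/3..1/2}"
proof -
  let ?V = "{1..n}" and ?K = "complete_edges {1..n}"
  define H where "H E \<longleftrightarrow> shows_halting ?V (normal_edges ?V E) f x" for E
  define I where "I = {E \<in> graphs_on n. has_isolated ?V E \<and> H E}"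
  define D where "D = {E \<in> graphs_on n. has_dominating ?V E \<and> H E}"
  have excl: "\<not> (has_isolated ?V E \<and> has_dominating ?V E)" for E
    using not_isolated_and_dominating[of ?V E] n by auto
  have "bij_betw (\<lambda>E. ?K - E) I D"
  proof (rule bij_betw_byWitness[where f' = "\<lambda>E. ?K - E"])
    show "(\<lambda>E. ?K - E) ` I \<subseteq> D"
    proof safe
      fix E assume "E \<in> I"
      then have E: "E \<subseteq> ?K" "has_isolated ?V E" "H E" by (auto simp: I_def graphs_on_eq)
      then have d: "has_dominating ?V (?K - E)" "\<not> has_dominating ?V E"
        using has_dominating_complement excl by blast+
      \<comment> \<open>Only \<open>?K - E\<close> has a dominating vertex, so it alone is
        complemented, which gives back \<open>E\<close>.\<close>
      with E(1) have "normal_edges ?V (?K - E) = normal_edges ?V E"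
        by (auto simp: normal_edges_def)
      with E d show "?K - E \<in> D" by (auto simp: D_def H_def graphs_on_eq)
    qed
    show "(\<lambda>E. ?K - E) ` D \<subseteq> I"
    proof safe
      fix E assume "E \<in> D"
      then have E: "E \<subseteq> ?K" "has_dominating ?V E" "H E" by (auto simp: D_def graphs_on_eq)
      then have d: "has_isolated ?V (?K - E)" "\<not> has_dominating ?V (?K - E)"
        using has_isolated_complement excl by blast+
      with E(2) have "normal_edges ?V (?K - E) = normal_edges ?V E"
        by (simp add: normal_edges_def)
      with E d show "?K - E \<in> I" by (auto simp: I_def H_def graphs_on_eq)
    qed
  qed (auto simp: I_def D_def graphs_on_eq)
  then have card: "card I = card D" by (rule bij_betw_same_card)
  have fin: "finite (graphs_on n)"
    by (auto simp: graphs_on_def intro: finite_subset[of _ "Pow {1..n}"])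
  then have finID: "finite I" "finite D" by (auto simp: I_def D_def)
  have "E0 \<in> I" using E0 by (simp add: I_def H_def)
  then have pos: "card I > 0" using finID by (auto simp: card_gt_0_iff)
  have sat: "graphs_sat n p = insert {} (I \<union> D)"
    using n by (auto simp: p graphs_sat_diagonal I_def D_def H_def graphs_on_def)
  have "I \<inter> D = {}" using excl by (auto simp: I_def D_def)
  then have cardID: "card (I \<union> D) = 2 * card D" using finID card by (simp add: card_Un_disjoint)
  have total: "2 * card D \<le> card (graphs_sat n p)" "card (graphs_sat n p) \<le> Suc (2 * card D)"
    unfolding sat using finID cardID card_insert_le[of "I \<union> D" "{}"] by (auto simp: card_insert_if)
  have dom: "graph_sat n E dominating_fm \<longleftrightarrow> has_dominating ?V E" for E
    by (simp add: graph_sat_def sat_dominating)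
  have "\<not> has_dominating ?V {}"
    using excl[of "{}"] n by (auto simp: has_isolated_def)
  then have "graphs_sat n p \<inter> {E. graph_sat n E dominating_fm} = D"
    unfolding sat dom using excl by (auto simp: I_def D_def)
  then have prob: "measure_pmf.prob (cond_graph n p) {E. graph_sat n E dominating_fm} =
      card D / card (graphs_sat n p)"
    using finID sat by (simp add: cond_graph_def measure_pmf_of_set)
  have "real (card (graphs_sat n p)) \<ge> 2 * real (card D)" "real (card (graphs_sat n p)) \<le> 3 * real (card D)"
    using total pos card by linarith+
  moreover have "real (card (graphs_sat n p)) > 0"
    using total pos card by linarith
  ultimately show ?thesis
    unfolding prob by (simp add: field_simps)
qed

lemma halting_not_obeys:
  assumes "computes f [x] y"
  shows "\<not> obeys_zero_one_law (diagonal_fm x (search_fm f))"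
proof
  define p where "p = diagonal_fm x (search_fm f)"
  let ?P = "\<lambda>n. measure_pmf.prob (cond_graph n p) {E. graph_sat n E dominating_fm}"
  assume "obeys_zero_one_law (diagonal_fm x (search_fm f))"
  moreover have "sentence dominating_fm"
    by (auto simp: sentence_def dominating_fm_def)
  ultimately obtain c :: real where c: "c \<in> {0, 1}" "(?P \<longlongrightarrow> c) (inf sequentially (principal (spectrum p)))"
    unfolding obeys_zero_one_law_def p_def by blast
  \<comment> \<open>Points of \<open>{1/3..1/2}\<close> have distance at least 1/3 from 0 and from
    1.\<close>
  from tendstoD[OF c(2), of "1/3"] obtain k where k: "\<And>n. n \<ge> k \<Longrightarrow> n \<in> spectrum p \<Longrightarrow> dist (?P n) c < 1/3"
    by (auto simp: eventually_inf_principal eventually_sequentially)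
  obtain n E where n: "n > max k 2" "E \<in> graphs_on n" "has_isolated {1..n} E"
      "shows_halting {1..n} (normal_edges {1..n} E) f x"
    using shows_halting_complete[OF assms, of "max k 2"] by blast
  then have "E \<in> graphs_sat n p"
    by (simp add: p_def graphs_sat_diagonal)
  then have "dist (?P n) c < 1/3"
    using n(1) by (intro k) (auto simp: spectrum_def)
  moreover have "?P n \<in> {1/3..1/2}"
    using n by (intro prob_dominating_bounds[OF _ n(2-4) p_def]) auto
  ultimately show False using c(1) by (auto simp: dist_real_def)
qed

section \<open>Diagonalisation\<close>

definition numeral_prog :: recf where
  "numeral_prog = PrimRec (const_prog (fm_code (numeral_fm 0)))
     (ex_prog 5 (conj_prog (const_prog (fm_code (succ_fm 6 5 4)))
       (ex_prog 4 (conj_prog (const_prog (fm_code (FEq 4 5))) (Proj 1)))))"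

lemma computes_numeral: "computes numeral_prog [n] (fm_code (numeral_fm n))"
proof (induction n)
  case 0
  show ?case unfolding numeral_prog_def by (intro PrimRec_0 computes_const)
next
  case (Suc n)
  \<comment> \<open>Argument 1 of the step program is the previous result of the recursion.\<close>
  have "computes (Proj 1) [n, fm_code (numeral_fm n)] (fm_code (numeral_fm n))"
    by (intro computes_Proj) auto
  with Suc show ?case unfolding numeral_prog_def numeral_fm.simps
    by (intro PrimRec_Suc computes_ex computes_conj computes_const)
qed

text \<open>The input is used twice: as the number whose numeral is formed, and by
  \<open>Proj 0\<close> as the code of the subformula.\<close>

definition diagonal_prog :: recf where
  "diagonal_prog = disj_prog (const_prog (fm_code edgeless_fm))
     (conj_prog (const_prog (fm_code (FDisj dominating_fm isolated_fm)))
       (ex_prog 0 (ex_prog 1 (ex_prog 2 (ex_prog 3 (ex_prog 4 (conj_prog numeral_prog (Proj 0))))))))"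

lemma computes_diagonal: "computes diagonal_prog [fm_code p] (fm_code (diagonal_fm (fm_code p) p))"
proof -
  have "computes (Proj 0) [fm_code p] (fm_code p)"
    by (intro computes_Proj) auto
  then show ?thesis
    unfolding diagonal_prog_def diagonal_fm_def instance_fm_def
    by (intro computes_disj computes_ex computes_conj computes_const computes_numeral)
qed

theorem theorem12:
  "\<not> recursively_enumerable (fm_code ` {\<phi>. sentence \<phi> \<and> obeys_zero_one_law \<phi>})"
proof
  assume "recursively_enumerable (fm_code ` {\<phi>. sentence \<phi> \<and> obeys_zero_one_law \<phi>})"
  then obtain f where f: "fm_code ` {\<phi>. sentence \<phi> \<and> obeys_zero_one_law \<phi>} = {x. \<exists>y. computes f [x] y}"
    unfolding recursively_enumerable_def by blast
  \<comment> \<open>Applied to the code of its own search formula, \<open>h\<close> runs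
    \<open>f\<close> on the code of \<open>\<phi>\<close>, and \<open>\<phi>\<close> obeys the law
    iff \<open>h\<close> does not halt on \<open>x\<close>.\<close>
  define h where "h = Comp f [diagonal_prog]"
  define x where "x = fm_code (search_fm h)"
  define \<phi> where "\<phi> = diagonal_fm x (search_fm h)"
  have \<phi>: "computes diagonal_prog [x] (fm_code \<phi>)"
    unfolding \<phi>_def x_def by (rule computes_diagonal)
  have "(\<exists>y. computes h [x] y) \<longleftrightarrow> (\<exists>y. computes f [fm_code \<phi>] y)"
  proof
    assume "\<exists>y. computes h [x] y"
    then obtain y where "computes (Comp f [diagonal_prog]) [x] y"
      unfolding h_def by blast
    then obtain v where "computes diagonal_prog [x] v" "computes f [v] y"
      by (elim computes_elims) (auto simp: list_all2_Cons1)
    with computes_functional[OF \<phi>] show "\<exists>y. computes f [fm_code \<phi>] y"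
      by blast
  next
    assume "\<exists>y. computes f [fm_code \<phi>] y"
    then show "\<exists>y. computes h [x] y"
      unfolding h_def using computes_Comp1[OF \<phi>] by blast
  qed
  also have "\<dots> \<longleftrightarrow> fm_code \<phi> \<in> fm_code ` {\<phi>. sentence \<phi> \<and> obeys_zero_one_law \<phi>}"
    unfolding f by simp
  also have "\<dots> \<longleftrightarrow> obeys_zero_one_law \<phi>"
    using sentence_diagonal by (auto simp: fm_code_eq_iff \<phi>_def)
  also have "\<dots> \<longleftrightarrow> (\<nexists>y. computes h [x] y)"
    unfolding \<phi>_def using not_halting_obeys halting_not_obeys by blast
  finally show False by blast
qed

end
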